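(* Let $\nu\in(0,1)$, let $\{S(t):t\geq 0\}$ be a real-valued Lévy process such that $\kappa_S(\theta):=\log\mathbb{E}[e^{\theta S(1)}]$ is finite in a neighborhood of $\theta=0$, and let $\{L_\nu(t):t\geq 0\}$ be an inverse of a stable subordinator of index $\nu$, independent of $\{S(t):t\geq 0\}$. Set $m:=\kappa_S'(0)$ and $q:=\kappa_S''(0)$, and let $$\alpha(\nu):=\begin{cases}1-\nu/2 & \text{if } m=0,\\ 1-\nu & \text{if } m\neq 0.\end{cases}$$ Assume moreover that $q>0$ if $m=0$. Then, for every family of positive numbers $\{a_t:t>0\}$ such that $a_t\to 0$ and $a_tt\to\infty$ as $t\to\infty$, the family of random variables $\left\{\frac{(a_tt)^{\alpha(\nu)}S(L_\nu(t))}{t}:t>0\right\}$ satisfies the large deviation principle with speed $1/a_t$ and good rate function $I_{\mathrm{MD}}(\cdot;m)$ defined as follows: if $m=0$, $$I_{\mathrm{MD}}(x;0):=\left((\nu/2)^{\nu/(2-\nu)}-(\nu/2)^{2/(2-\nu)}\right)\left(\frac{2x^2}{q}\right)^{1/(2-\nu)};$$ if $m\neq 0$, $$I_{\mathrm{MD}}(x;m):=\begin{cases}\left(\nu^{\nu/(1-\nu)}-\nu^{1/(1-\nu)}\right)\left(\frac{x}{m}\right)^{1/(1-\nu)} & \text{if } \frac{x}{m}\geq 0,\\ \infty & \text{if } \frac{x}{m}<0.\end{cases}$$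
   Context: Inverse of a stable subordinator: for $\nu\in(0,1)$, $L_\nu(t)=\inf\{u\geq 0: H_\nu(u)>t\}$, where $\{H_\nu(u):u\ge 0\}$ is the stable subordinator with $\mathbb{E}[e^{-\xi H_\nu(u)}]=e^{-u\xi^\nu}$ for $\xi\geq 0$. Its moment generating function is $\mathbb{E}[e^{\theta L_\nu(t)}]=E_\nu(\theta t^\nu)$ for all $\theta\in\mathbb{R}$, where $E_\nu(x):=\sum_{k=0}^\infty\frac{x^k}{\Gamma(\nu k+1)}$ is the Mittag-Leffler function. Large deviation principle (LDP): a family of real random variables $\{Z(t):t>0\}$ satisfies the LDP with speed $v_t\to\infty$ and rate function $I:\mathbb{R}\to[0,\infty]$ (lower semicontinuous) if $\limsup_{t\to\infty}\frac{1}{v_t}\log P(Z(t)\in C)\leq-\inf_{x\in C}I(x)$ for all closed sets $C$ and $\liminf_{t\to\infty}\frac{1}{v_t}\log P(Z(t)\in O)\geq-\inf_{x\in O}I(x)$ for all open sets $O$. The rate function $I$ is good if all level sets $\{x\in\mathbb{R}:I(x)\leq b\}$, $b\geq 0$, are compact. *)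

theory Defs
  imports "HOL-Probability.Probability"
begin

text \<open>Real-valued processes are functions \<open>X :: real \<Rightarrow> 'a \<Rightarrow> real\<close>; only the times \<open>t \<ge> 0\<close> matter.\<close>

definition cadlag :: "(real \<Rightarrow> real) \<Rightarrow> bool" where
  "cadlag f \<longleftrightarrow>
     (\<forall>t\<ge>0. (f \<longlongrightarrow> f t) (at_right t)) \<and>
     (\<forall>t>0. \<exists>l. (f \<longlongrightarrow> l) (at_left t))"

definition independent_increments :: "'a measure \<Rightarrow> (real \<Rightarrow> 'a \<Rightarrow> real) \<Rightarrow> bool" where
  "independent_increments M X \<longleftrightarrow>
     (\<forall>(n::nat) (s::nat \<Rightarrow> real). 0 \<le> s 0 \<longrightarrow> (\<forall>i<n. s i < s (Suc i)) \<longrightarrow>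
        prob_space.indep_vars M (\<lambda>_. borel) (\<lambda>i \<omega>. X (s (Suc i)) \<omega> - X (s i) \<omega>) {..<n})"

definition stationary_increments :: "'a measure \<Rightarrow> (real \<Rightarrow> 'a \<Rightarrow> real) \<Rightarrow> bool" where
  "stationary_increments M X \<longleftrightarrow>
     (\<forall>s\<ge>0. \<forall>t\<ge>0. distr M borel (\<lambda>\<omega>. X (s + t) \<omega> - X s \<omega>) = distr M borel (X t))"

text \<open>Stochastic continuity is not listed, since it follows from the other clauses. All paths, not
  just almost all, are cadlag: this makes \<open>X\<close> jointly measurable, so that composing it with an
  independent random time gives a random variable also when \<open>M\<close> is not complete.\<close>

definition levy_process :: "'a measure \<Rightarrow> (real \<Rightarrow> 'a \<Rightarrow> real) \<Rightarrow> bool" where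
  "levy_process M X \<longleftrightarrow>
     (\<forall>t\<ge>0. X t \<in> borel_measurable M) \<and>
     (AE \<omega> in M. X 0 \<omega> = 0) \<and>
     independent_increments M X \<and>
     stationary_increments M X \<and>
     (\<forall>\<omega>\<in>space M. cadlag (\<lambda>t. X t \<omega>))"

definition stable_subordinator :: "'a measure \<Rightarrow> real \<Rightarrow> (real \<Rightarrow> 'a \<Rightarrow> real) \<Rightarrow> bool" where
  "stable_subordinator M \<nu> H \<longleftrightarrow>
     levy_process M H \<and>
     (AE \<omega> in M. mono_on {0..} (\<lambda>u. H u \<omega>)) \<and>
     (\<forall>u\<ge>0. \<forall>\<xi>\<ge>0. integrable M (\<lambda>\<omega>. exp (- \<xi> * H u \<omega>)) \<and>
        prob_space.expectation M (\<lambda>\<omega>. exp (- \<xi> * H u \<omega>)) = exp (- u * \<xi> powr \<nu>))"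

text \<open>The paths of a stable subordinator are unbounded only almost surely, and the infimum of the
  empty set is unspecified on the reals. Hence the hitting-time formula is imposed almost surely,
  and measurability and nonnegativity of \<open>L\<close> are required separately.\<close>

definition inverse_stable_subordinator :: "'a measure \<Rightarrow> real \<Rightarrow> (real \<Rightarrow> 'a \<Rightarrow> real) \<Rightarrow> bool" where
  "inverse_stable_subordinator M \<nu> L \<longleftrightarrow>
     (\<forall>t\<ge>0. L t \<in> borel_measurable M \<and> (\<forall>\<omega>\<in>space M. 0 \<le> L t \<omega>)) \<and>
     (\<exists>H. stable_subordinator M \<nu> H \<and>
        (AE \<omega> in M. \<forall>t\<ge>0. L t \<omega> = Inf {u. 0 \<le> u \<and> t < H u \<omega>}))"

text \<open>Independence of whole processes, as random elements of the path space with the product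
  \<open>\<sigma>\<close>-algebra.\<close>

definition independent_processes ::
    "'a measure \<Rightarrow> (real \<Rightarrow> 'a \<Rightarrow> real) \<Rightarrow> (real \<Rightarrow> 'a \<Rightarrow> real) \<Rightarrow> bool" where
  "independent_processes M X Y \<longleftrightarrow>
     prob_space.indep_var M
       (PiM {0..} (\<lambda>_. borel)) (\<lambda>\<omega>. \<lambda>t\<in>{0..}. X t \<omega>)
       (PiM {0..} (\<lambda>_. borel)) (\<lambda>\<omega>. \<lambda>t\<in>{0..}. Y t \<omega>)"

text \<open>Meaningful only at those \<open>\<theta>\<close> for which \<open>exp (\<theta> X)\<close> is integrable.\<close>

definition cgf :: "'a measure \<Rightarrow> ('a \<Rightarrow> real) \<Rightarrow> real \<Rightarrow> real" where
  "cgf M X \<theta> = ln (prob_space.expectation M (\<lambda>\<omega>. exp (\<theta> * X \<omega>)))"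

definition cgf_finite_near_0 :: "'a measure \<Rightarrow> ('a \<Rightarrow> real) \<Rightarrow> bool" where
  "cgf_finite_near_0 M X \<longleftrightarrow> (\<forall>\<^sub>F \<theta> in nhds 0. integrable M (\<lambda>\<omega>. exp (\<theta> * X \<omega>)))"

definition rate_function :: "(real \<Rightarrow> ereal) \<Rightarrow> bool" where
  "rate_function I \<longleftrightarrow> (\<forall>x. 0 \<le> I x) \<and> (\<forall>x. I x \<le> Liminf (at x) I)"

definition good_rate_function :: "(real \<Rightarrow> ereal) \<Rightarrow> bool" where
  "good_rate_function I \<longleftrightarrow>
     rate_function I \<and> (\<forall>b::real. 0 \<le> b \<longrightarrow> compact {x. I x \<le> ereal b})"

definition log_prob :: "'a measure \<Rightarrow> 'a set \<Rightarrow> ereal" where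
  "log_prob M A = (if measure M A = 0 then -\<infinity> else ereal (ln (measure M A)))"

definition LDP :: "'a measure \<Rightarrow> (real \<Rightarrow> 'a \<Rightarrow> real) \<Rightarrow> (real \<Rightarrow> real) \<Rightarrow> (real \<Rightarrow> ereal) \<Rightarrow> bool" where
  "LDP M Z v I \<longleftrightarrow>
     (\<forall>t>0. Z t \<in> borel_measurable M) \<and>
     filterlim v at_top at_top \<and>
     rate_function I \<and>
     (\<forall>C. closed C \<longrightarrow>
        Limsup at_top (\<lambda>t. ereal (1 / v t) * log_prob M {\<omega> \<in> space M. Z t \<omega> \<in> C})
          \<le> - (INF x\<in>C. I x)) \<and>
     (\<forall>U. open U \<longrightarrow>
        - (INF x\<in>U. I x)
          \<le> Liminf at_top (\<lambda>t. ereal (1 / v t) * log_prob M {\<omega> \<in> space M. Z t \<omega> \<in> U}))"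

definition MD_exponent :: "real \<Rightarrow> real \<Rightarrow> real" where
  "MD_exponent \<nu> m = (if m = 0 then 1 - \<nu> / 2 else 1 - \<nu>)"

definition I_MD :: "real \<Rightarrow> real \<Rightarrow> real \<Rightarrow> real \<Rightarrow> ereal" where
  "I_MD \<nu> q m x =
     (if m = 0 then
        ereal (((\<nu> / 2) powr (\<nu> / (2 - \<nu>)) - (\<nu> / 2) powr (2 / (2 - \<nu>)))
               * (2 * x\<^sup>2 / q) powr (1 / (2 - \<nu>)))
      else if 0 \<le> x / m then
        ereal ((\<nu> powr (\<nu> / (1 - \<nu>)) - \<nu> powr (1 / (1 - \<nu>)))
               * (x / m) powr (1 / (1 - \<nu>)))
      else \<infinity>)"

end

theory Submission
  imports Defs "HOL-Real_Asymp.Real_Asymp"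
begin

text \<open>
  Write \<open>Z\<close> for the rescaled process, \<open>\<kappa>\<close> for the cumulant generating function of \<open>S 1\<close> and
  \<open>p\<close> for the exponent of \<open>a\<^sub>t t\<close> in \<open>Z\<close>. The proof
  computes the limit \<open>\<Lambda> \<theta>\<close> of \<open>a\<^sub>t ln E exp (\<theta> Z\<^sub>t / a\<^sub>t)\<close>, recognises the rate function as the Legendre
  transform of \<open>\<Lambda>\<close>, and concludes by the Gaertner-Ellis theorem.

  Here \<open>\<theta> Z\<^sub>t / a\<^sub>t = s\<^sub>t S (L\<^sub>t)\<close> with \<open>s\<^sub>t = \<theta> (a\<^sub>t t) powr (p - 1) \<longlongrightarrow> 0\<close>, and integrating out \<open>S\<close> first
  gives \<open>E exp (s S (L\<^sub>t)) = E exp (\<kappa> s L\<^sub>t)\<close> for small \<open>s\<close> (\<open>levy_mgf_at_independent_time\<close>). The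
  exponent \<open>p\<close> is the one for which \<open>\<kappa> s\<^sub>t (a\<^sub>t t) powr \<nu>\<close> converges: by the expansion of \<open>\<kappa>\<close> at the origin
  (\<open>cgf_near_0\<close>), to \<open>c = m \<theta>\<close> if \<open>m \<noteq> 0\<close> and to \<open>c = q \<theta>\<^sup>2 / 2\<close> if \<open>m = 0\<close>.

  What remains is the logarithmic size of \<open>E exp (l L\<^sub>t)\<close>. For \<open>l \<ge> 0\<close> it is \<open>l powr (1 / \<nu>) t\<close>, because
  \<open>exp (l u - \<xi> H u)\<close> is a martingale for \<open>\<xi> = l powr (1 / \<nu>)\<close>, and under the measure with this density \<open>H\<close>
  jumps over the level \<open>t\<close> by an amount of order \<open>1 / \<xi>\<close>. Two one-sided forms of this suffice. Optional
  stopping and \<open>H (L\<^sub>t) \<ge> t\<close> give \<open>E exp (l L\<^sub>t) \<ge> exp (\<xi> t)\<close> exactly, and a Chernoff bound for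
  \<open>{L\<^sub>t > u} \<subseteq> {H u \<le> t}\<close> gives the converse up to a factor \<open>1 + e\<close> in \<open>l\<close> and a constant depending on \<open>e\<close>
  alone. For \<open>l < 0\<close>, Jensen's inequality and \<open>E L\<^sub>t = O (t powr \<nu>)\<close> bound \<open>- ln E exp (l L\<^sub>t)\<close> by a multiple of
  \<open>\<bar>l\<bar> t powr \<nu>\<close>, which for \<open>l = \<kappa> s\<^sub>t\<close> is negligible compared with \<open>1 / a\<^sub>t\<close>. Together
  \<open>\<Lambda> \<theta> = max 0 c powr (1 / \<nu>)\<close> (\<open>inverse_subordinator_log_mgf_limit\<close>).

  As \<open>1 / \<nu> > 1\<close>, the function \<open>\<Lambda>\<close> is differentiable everywhere, and its derivative takes every value at
  which the rate function is finite. That is what the lower bound of the Gaertner-Ellis theorem requires.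
\<close>

section \<open>The cumulant generating function near the origin\<close>

context prob_space
begin

lemma expectation_exp_pos:
  assumes "integrable M (\<lambda>\<omega>. exp (Y \<omega> :: real))"
  shows "0 < expectation (\<lambda>\<omega>. exp (Y \<omega>))"
proof -
  have "0 \<noteq> expectation (\<lambda>\<omega>. exp (Y \<omega>))"
    using integral_nonneg_eq_0_iff_AE[OF assms] by auto
  moreover have "0 \<le> expectation (\<lambda>\<omega>. exp (Y \<omega>))" by simp
  ultimately show ?thesis by linarith
qed

text \<open>
  Expand the exponential and integrate term by term. The partial sums of \<open>\<bar>s X\<bar> ^ n / n!\<close> are dominated by
  \<open>exp \<bar>s X\<bar> \<le> exp (r X) + exp (- r X)\<close>.
\<close>

lemma mgf_power_series:
  fixes X :: "'a \<Rightarrow> real"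
  assumes [measurable]: "X \<in> borel_measurable M"
    and int: "integrable M (\<lambda>\<omega>. exp (r * X \<omega>))" "integrable M (\<lambda>\<omega>. exp (- r * X \<omega>))"
    and s: "\<bar>s\<bar> \<le> r"
  shows "(\<lambda>n. expectation (\<lambda>\<omega>. X \<omega> ^ n) / fact n * s ^ n) sums expectation (\<lambda>\<omega>. exp (s * X \<omega>))"
proof -
  define f where "f n \<omega> = (s * X \<omega>) ^ n / fact n" for n \<omega>
  have f_meas [measurable]: "f n \<in> borel_measurable M" for n
    unfolding f_def by measurable
  have exp_sums: "(\<lambda>n. y ^ n / fact n) sums exp y" for y :: real
    using exp_converges[of y] by (simp add: field_simps)
  have norm_f: "norm (f n \<omega>) = \<bar>s * X \<omega>\<bar> ^ n / fact n" for n \<omega>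
    by (simp add: f_def power_abs)
  have exp_abs: "exp \<bar>s * X \<omega>\<bar> \<le> exp (r * X \<omega>) + exp (- r * X \<omega>)" for \<omega>
  proof -
    have "\<bar>s * X \<omega>\<bar> \<le> \<bar>r * X \<omega>\<bar>"
      using s by (simp add: abs_mult mult_right_mono)
    hence "exp \<bar>s * X \<omega>\<bar> \<le> exp \<bar>r * X \<omega>\<bar>" by simp
    also have "\<dots> \<le> exp (r * X \<omega>) + exp (- r * X \<omega>)"
      by (cases "0 \<le> r * X \<omega>") (auto simp: abs_if)
    finally show ?thesis .
  qed
  have partial: "(\<Sum>n<k. norm (f n \<omega>)) \<le> exp (r * X \<omega>) + exp (- r * X \<omega>)" for k \<omega>
  proof -
    have "(\<Sum>n<k. norm (f n \<omega>)) \<le> exp \<bar>s * X \<omega>\<bar>"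
      unfolding norm_f using sum_le_suminf[of "\<lambda>n. \<bar>s * X \<omega>\<bar> ^ n / fact n" "{..<k}"]
        exp_sums[of "\<bar>s * X \<omega>\<bar>"] by (auto simp: sums_iff)
    with exp_abs[of \<omega>] show ?thesis by linarith
  qed
  have dom: "integrable M (\<lambda>\<omega>. exp (r * X \<omega>) + exp (- r * X \<omega>))"
    using int by simp
  have f_int: "integrable M (f n)" for n
  proof (rule Bochner_Integration.integrable_bound[OF dom])
    show "AE \<omega> in M. norm (f n \<omega>) \<le> norm (exp (r * X \<omega>) + exp (- r * X \<omega>))"
    proof (rule AE_I2)
      fix \<omega>
      have "norm (f n \<omega>) \<le> (\<Sum>n<Suc n. norm (f n \<omega>))"
        by (intro member_le_sum) auto
      also note partial
      finally show "norm (f n \<omega>) \<le> norm (exp (r * X \<omega>) + exp (- r * X \<omega>))" by simp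
    qed
  qed simp
  have "summable (\<lambda>n. \<integral>\<omega>. norm (f n \<omega>) \<partial>M)"
  proof (rule summableI_nonneg_bounded)
    fix k
    have "(\<Sum>n<k. \<integral>\<omega>. norm (f n \<omega>) \<partial>M) = (\<integral>\<omega>. (\<Sum>n<k. norm (f n \<omega>)) \<partial>M)"
      using f_int by (intro Bochner_Integration.integral_sum[symmetric]) auto
    also have "\<dots> \<le> (\<integral>\<omega>. exp (r * X \<omega>) + exp (- r * X \<omega>) \<partial>M)"
      using f_int partial dom by (intro integral_mono) auto
    finally show "(\<Sum>n<k. \<integral>\<omega>. norm (f n \<omega>) \<partial>M) \<le> (\<integral>\<omega>. exp (r * X \<omega>) + exp (- r * X \<omega>) \<partial>M)" .
  qed auto
  moreover have "AE \<omega> in M. summable (\<lambda>n. norm (f n \<omega>))"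
    unfolding norm_f using exp_sums by (auto simp: sums_iff)
  ultimately have "(\<lambda>n. integral\<^sup>L M (f n)) sums (\<integral>\<omega>. (\<Sum>n. f n \<omega>) \<partial>M)"
    using f_int by (intro sums_integral) auto
  moreover have "integral\<^sup>L M (f n) = expectation (\<lambda>\<omega>. X \<omega> ^ n) / fact n * s ^ n" for n
    unfolding f_def by (simp add: power_mult_distrib mult.commute)
  moreover have "(\<Sum>n. f n \<omega>) = exp (s * X \<omega>)" for \<omega>
    unfolding f_def using exp_sums by (simp add: sums_iff)
  ultimately show ?thesis by simp
qed

text \<open>
  The moment generating function is a power series near the origin, hence smooth there, so that the iterated
  derivatives in the statement exist. The second limit is l'Hospital's rule applied once, followed by the
  definition of the derivative of \<open>\<kappa>'\<close> at the origin, where \<open>\<kappa>'\<close> vanishes.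
\<close>

lemma cgf_near_0:
  fixes X :: "'a \<Rightarrow> real"
  assumes X [measurable]: "X \<in> borel_measurable M" and fin: "cgf_finite_near_0 M X"
  shows "((\<lambda>s. cgf M X s / s) \<longlongrightarrow> deriv (cgf M X) 0) (at 0)"
    and "deriv (cgf M X) 0 = 0 \<Longrightarrow>
      ((\<lambda>s. cgf M X s / s\<^sup>2) \<longlongrightarrow> deriv (deriv (cgf M X)) 0 / 2) (at 0)"
proof -
  obtain r where r: "0 < r" and int: "\<And>s. \<bar>s\<bar> < r \<Longrightarrow> integrable M (\<lambda>\<omega>. exp (s * X \<omega>))"
    using fin unfolding cgf_finite_near_0_def eventually_nhds_metric by (auto simp: dist_real_def)
  define R where "R = r / 2"
  have R: "0 < R" "R < r" using r by (auto simp: R_def)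
  define c where "c n = expectation (\<lambda>\<omega>. X \<omega> ^ n) / fact n" for n
  define m0 where "m0 s = (\<Sum>n. c n * s ^ n)" for s
  define m1 where "m1 s = (\<Sum>n. diffs c n * s ^ n)" for s
  define m2 where "m2 s = (\<Sum>n. diffs (diffs c) n * s ^ n)" for s
  have sums: "(\<lambda>n. c n * s ^ n) sums expectation (\<lambda>\<omega>. exp (s * X \<omega>))" if "\<bar>s\<bar> \<le> R" for s
    unfolding c_def using mgf_power_series[OF X, of R s] int[of R] int[of "-R"] R that by simp
  have mgf: "expectation (\<lambda>\<omega>. exp (s * X \<omega>)) = m0 s" if "\<bar>s\<bar> \<le> R" for s
    using sums[OF that] by (simp add: m0_def sums_iff)
  have m0_pos: "0 < m0 s" if "\<bar>s\<bar> \<le> R" for s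
    using expectation_exp_pos[OF int, of s] mgf[OF that] that R by simp
  have summ: "summable (\<lambda>n. c n * R ^ n)" using sums[of R] R by (auto simp: sums_iff)
  have D0: "DERIV m0 s :> m1 s" if "\<bar>s\<bar> < R" for s
    unfolding m0_def[abs_def] m1_def using termdiffs_strong[OF summ] that R by simp
  have "summable (\<lambda>n. diffs c n * (R / 2) ^ n)"
    by (rule termdiff_converges[of _ R])
       (use R sums in \<open>auto simp: sums_iff\<close>)
  hence D1: "DERIV m1 s :> m2 s" if "\<bar>s\<bar> < R / 2" for s
    unfolding m1_def[abs_def] m2_def using termdiffs_strong[of "diffs c" "R / 2" s] that R by simp
  define k1 where "k1 s = m1 s / m0 s" for s
  have nhds_R: "\<forall>\<^sub>F s in nhds 0. \<bar>s\<bar> < R"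
    using R by (auto simp: eventually_nhds_metric dist_real_def)
  have cgf_eq: "cgf M X s = ln (m0 s)" if "\<bar>s\<bar> < R" for s
    using mgf that by (simp add: cgf_def)
  have Dk: "DERIV (cgf M X) s :> k1 s" if s: "\<bar>s\<bar> < R" for s
  proof -
    have "DERIV (\<lambda>s. ln (m0 s)) s :> k1 s"
      unfolding k1_def using D0[OF s] m0_pos[of s] s
      by (auto intro!: derivative_eq_intros simp: field_simps)
    moreover have "\<forall>\<^sub>F x in nhds s. cgf M X x = ln (m0 x)"
      using s eventually_nhds_in_open[of "{-R<..<R}" s]
      by (auto elim!: eventually_mono simp: cgf_eq abs_less_iff)
    ultimately show ?thesis
      using DERIV_cong_ev[of s s "cgf M X" "\<lambda>s. ln (m0 s)" "k1 s" "k1 s"] by simp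
  qed
  have k1_0: "deriv (cgf M X) 0 = k1 0"
    using Dk[of 0] R by (simp add: DERIV_imp_deriv)
  have Dk1: "DERIV k1 0 :> deriv k1 0"
  proof -
    have "m0 0 \<noteq> 0" using m0_pos[of 0] R by simp
    hence "DERIV k1 0 :> (m2 0 * m0 0 - m1 0 * m1 0) / (m0 0 * m0 0)"
      unfolding k1_def[abs_def] using D1[of 0] D0[of 0] R
      by (auto intro!: derivative_eq_intros)
    thus ?thesis by (simp add: DERIV_imp_deriv)
  qed
  have k2_0: "deriv (deriv (cgf M X)) 0 = deriv k1 0"
  proof (rule deriv_cong_ev)
    show "\<forall>\<^sub>F s in nhds 0. deriv (cgf M X) s = k1 s"
      using nhds_R by eventually_elim (simp add: Dk DERIV_imp_deriv)
  qed simp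
  have cgf_0: "cgf M X 0 = 0"
    by (simp add: cgf_def prob_space)
  show "((\<lambda>s. cgf M X s / s) \<longlongrightarrow> deriv (cgf M X) 0) (at 0)"
    using Dk[of 0] R cgf_0 by (simp add: k1_0 DERIV_def)
  assume "deriv (cgf M X) 0 = 0"
  hence k1_zero: "k1 0 = 0" by (simp add: k1_0)
  show "((\<lambda>s. cgf M X s / s\<^sup>2) \<longlongrightarrow> deriv (deriv (cgf M X)) 0 / 2) (at 0)"
  proof (rule lhopital)
    show "(cgf M X \<longlongrightarrow> 0) (at 0)"
      using DERIV_isCont[OF Dk[of 0]] R cgf_0 by (simp add: isCont_def)
    show "((\<lambda>s. s\<^sup>2) \<longlongrightarrow> (0::real)) (at 0)"
      by (auto intro!: tendsto_eq_intros)
    show "\<forall>\<^sub>F s in at 0. DERIV (cgf M X) s :> k1 s"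
      using nhds_R by (auto simp: eventually_at_filter Dk elim: eventually_mono)
    show "\<forall>\<^sub>F s::real in at 0. DERIV (\<lambda>s. s\<^sup>2) s :> 2 * s"
      by (auto intro!: always_eventually derivative_eq_intros)
    have "((\<lambda>s. k1 s / s / 2) \<longlongrightarrow> deriv k1 0 / 2) (at 0)"
      using Dk1 k1_zero by (intro tendsto_divide) (auto simp: DERIV_def)
    thus "((\<lambda>s. k1 s / (2 * s)) \<longlongrightarrow> deriv (deriv (cgf M X)) 0 / 2) (at 0)"
      by (simp add: k2_0 mult.commute)
  qed (auto simp: eventually_at_filter)
qed

end

section \<open>The Gaertner-Ellis theorem on the real line\<close>

lemma log_prob_le:
  assumes "0 < c" "measure M A \<le> exp r"
  shows "ereal c * log_prob M A \<le> ereal (c * r)"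
proof (cases "measure M A = 0")
  case False
  hence "0 < measure M A" using zero_less_measure_iff by blast
  hence "ln (measure M A) \<le> r" using assms(2) by (metis ln_exp ln_le_cancel_iff exp_gt_zero)
  thus ?thesis using assms(1) False by (simp add: log_prob_def)
qed (use assms in \<open>simp add: log_prob_def\<close>)

lemma log_prob_ge:
  assumes "0 < c" "exp r \<le> measure M A"
  shows "ereal (c * r) \<le> ereal c * log_prob M A"
proof -
  have pos: "0 < measure M A" using assms(2) exp_gt_zero[of r] by linarith
  hence "r \<le> ln (measure M A)" using assms(2) by (simp add: ln_ge_iff)
  thus ?thesis using assms(1) pos by (simp add: log_prob_def)
qed

lemma ereal_le_uminus_swap: "(a::ereal) \<le> - b \<longleftrightarrow> b \<le> - a"
  by (cases a; cases b) auto

context prob_space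
begin

text \<open>
  On the event, \<open>exp (\<theta> Y) \<le> exp (\<eta> (Y - y)) exp (\<theta> Y)\<close>. The sign of \<open>\<eta>\<close> selects the right or the left tail;
  \<open>\<theta> = 0\<close> is the usual Chernoff bound, and general \<open>\<theta>\<close> controls tails under exponential tilting.
\<close>

lemma tilted_chernoff:
  fixes Y :: "'a \<Rightarrow> real"
  assumes Y [measurable]: "Y \<in> borel_measurable M"
    and int: "integrable M (\<lambda>\<omega>. exp (\<theta> * Y \<omega>))" "integrable M (\<lambda>\<omega>. exp ((\<theta> + \<eta>) * Y \<omega>))"
  shows "(\<integral>\<omega>. indicator {\<omega> \<in> space M. \<eta> * y \<le> \<eta> * Y \<omega>} \<omega> * exp (\<theta> * Y \<omega>) \<partial>M)
    \<le> exp (- \<eta> * y) * expectation (\<lambda>\<omega>. exp ((\<theta> + \<eta>) * Y \<omega>))"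
proof -
  have "(\<integral>\<omega>. indicator {\<omega> \<in> space M. \<eta> * y \<le> \<eta> * Y \<omega>} \<omega> * exp (\<theta> * Y \<omega>) \<partial>M)
    \<le> (\<integral>\<omega>. exp (- \<eta> * y) * exp ((\<theta> + \<eta>) * Y \<omega>) \<partial>M)"
  proof (rule integral_mono)
    show "integrable M (\<lambda>\<omega>. indicator {\<omega> \<in> space M. \<eta> * y \<le> \<eta> * Y \<omega>} \<omega> * exp (\<theta> * Y \<omega>))"
      using integrable_mult_indicator[OF _ int(1), of "{\<omega> \<in> space M. \<eta> * y \<le> \<eta> * Y \<omega>}"] by simp
    show "integrable M (\<lambda>\<omega>. exp (- \<eta> * y) * exp ((\<theta> + \<eta>) * Y \<omega>))"
      using int(2) by simp
    show "indicator {\<omega> \<in> space M. \<eta> * y \<le> \<eta> * Y \<omega>} \<omega> * exp (\<theta> * Y \<omega>)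
      \<le> exp (- \<eta> * y) * exp ((\<theta> + \<eta>) * Y \<omega>)" for \<omega>
      by (auto simp: indicator_def algebra_simps simp flip: exp_add)
  qed
  thus ?thesis by simp
qed

text \<open>
  The two hypotheses on \<open>I\<close> replace convex duality. \<open>dual\<close> says that \<open>I\<close> is at most the Legendre transform of
  \<open>\<Lambda>\<close>, where at \<open>x\<close> only slopes \<open>\<theta>\<close> of the sign of \<open>x\<close> are tried; then the Chernoff bound for the half line
  beyond \<open>x\<close>, away from the origin, has exponent \<open>I x\<close>. A closed set avoiding the origin is covered by the two half lines
  that start at its points closest to the origin, which yields the upper bound.

  \<open>exposed\<close> says that every \<open>x\<close> of finite rate is the slope of \<open>\<Lambda>\<close> at some \<open>\<theta>\<close>. Tilting the law of \<open>Z\<^sub>t\<close> by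
  \<open>exp (\<theta> Z\<^sub>t / a\<^sub>t)\<close> then makes \<open>Z\<^sub>t\<close> concentrate at \<open>x\<close>: the tilted tails on either side of \<open>x\<close> are
  exponentially small because \<open>\<Lambda> (\<theta> + h) - \<Lambda> \<theta>\<close> is close to \<open>h x\<close>. Undoing the tilt costs
  \<open>\<theta> x - \<Lambda> \<theta>\<close>, which is the lower bound.
\<close>

theorem Gartner_Ellis_real:
  fixes Z :: "real \<Rightarrow> 'a \<Rightarrow> real" and a \<Lambda> :: "real \<Rightarrow> real" and I :: "real \<Rightarrow> ereal"
  assumes Z: "\<And>t. 0 < t \<Longrightarrow> Z t \<in> borel_measurable M"
    and a_pos: "\<And>t. 0 < t \<Longrightarrow> 0 < a t" and a_lim: "(a \<longlongrightarrow> 0) at_top"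
    and int: "\<And>\<theta>. \<forall>\<^sub>F t in at_top. integrable M (\<lambda>\<omega>. exp (\<theta> / a t * Z t \<omega>))"
    and lim: "\<And>\<theta>. ((\<lambda>t. a t * ln (expectation (\<lambda>\<omega>. exp (\<theta> / a t * Z t \<omega>)))) \<longlongrightarrow> \<Lambda> \<theta>) at_top"
    and rate: "rate_function I" and I_0: "I 0 = 0"
    and dual: "\<And>x K. ereal K < I x \<Longrightarrow> \<exists>\<theta>. 0 \<le> \<theta> * x \<and> K < \<theta> * x - \<Lambda> \<theta>"
    and exposed: "\<And>x. I x \<noteq> \<infinity> \<Longrightarrow> \<exists>\<theta>. DERIV \<Lambda> \<theta> :> x \<and> ereal (\<theta> * x - \<Lambda> \<theta>) \<le> I x"
  shows "LDP M Z (\<lambda>t. 1 / a t) I"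
proof -
  define E where "E \<theta> t = expectation (\<lambda>\<omega>. exp (\<theta> / a t * Z t \<omega>))" for \<theta> t
  have t_pos: "\<forall>\<^sub>F t in at_top. (0::real) < t" by (rule eventually_gt_at_top)
  have inv_a: "filterlim (\<lambda>t. 1 / a t) at_top at_top"
  proof -
    have a_ev: "\<forall>\<^sub>F t in at_top. a t \<in> {0<..} \<and> a t \<noteq> 0"
      using t_pos by eventually_elim (simp add: a_pos less_imp_neq[OF a_pos, symmetric])
    have "filterlim a (at_right 0) at_top"
      unfolding filterlim_at using a_lim a_ev by simp
    thus ?thesis
      using filterlim_compose[OF filterlim_inverse_at_top_right] by (simp add: divide_inverse)
  qed
  have E_pos: "\<forall>\<^sub>F t in at_top. 0 < E \<theta> t" for \<theta>
    using int[of \<theta>] unfolding E_def by eventually_elim (rule expectation_exp_pos)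
  have E_le: "\<forall>\<^sub>F t in at_top. E \<theta> t \<le> exp (r / a t)" if "\<Lambda> \<theta> < r" for \<theta> r
    using order_tendstoD(2)[OF lim that] E_pos[of \<theta>] t_pos
  proof eventually_elim
    case (elim t)
    hence "ln (E \<theta> t) \<le> r / a t"
      using a_pos[of t] by (simp add: E_def field_simps)
    hence "exp (ln (E \<theta> t)) \<le> exp (r / a t)" by simp
    thus ?case using elim by simp
  qed
  have E_ge: "\<forall>\<^sub>F t in at_top. exp (r / a t) \<le> E \<theta> t" if "r < \<Lambda> \<theta>" for \<theta> r
    using order_tendstoD(1)[OF lim that] E_pos[of \<theta>] t_pos
  proof eventually_elim
    case (elim t)
    hence "r / a t \<le> ln (E \<theta> t)"
      using a_pos[of t] by (simp add: E_def field_simps)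
    thus ?case using elim by (simp add: ln_ge_iff)
  qed
  have tail: "\<forall>\<^sub>F t in at_top.
      (\<integral>\<omega>. indicator {\<omega> \<in> space M. \<eta> * y \<le> \<eta> * Z t \<omega>} \<omega> * exp (\<theta> / a t * Z t \<omega>) \<partial>M) \<le> exp (r / a t)"
    if r: "\<Lambda> (\<theta> + \<eta>) - \<eta> * y < r" for \<eta> y \<theta> r
  proof -
    have "\<Lambda> (\<theta> + \<eta>) < r + \<eta> * y" using r by simp
    from E_le[OF this] int[of \<theta>] int[of "\<theta> + \<eta>"] t_pos show ?thesis
    proof eventually_elim
      case (elim t)
      have a: "0 < a t" using a_pos elim by simp
      have Y: "Z t \<in> borel_measurable M" using Z elim by simp
      have "(\<integral>\<omega>. indicator {\<omega> \<in> space M. \<eta> / a t * y \<le> \<eta> / a t * Z t \<omega>} \<omega> * exp (\<theta> / a t * Z t \<omega>) \<partial>M)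
        \<le> exp (- (\<eta> / a t) * y) * expectation (\<lambda>\<omega>. exp ((\<theta> / a t + \<eta> / a t) * Z t \<omega>))"
        using elim by (intro tilted_chernoff Y) (simp_all add: add_divide_distrib)
      also have "\<dots> = exp (- (\<eta> / a t) * y) * E (\<theta> + \<eta>) t"
        by (simp add: E_def add_divide_distrib)
      also have "\<dots> \<le> exp (- (\<eta> / a t) * y) * exp ((r + \<eta> * y) / a t)"
        using elim by (intro mult_left_mono) auto
      also have "\<dots> = exp (r / a t)"
        by (simp add: add_divide_distrib flip: exp_add)
      also have "{\<omega> \<in> space M. \<eta> / a t * y \<le> \<eta> / a t * Z t \<omega>} = {\<omega> \<in> space M. \<eta> * y \<le> \<eta> * Z t \<omega>}"
        using a by (simp add: divide_right_mono field_simps)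
      finally show ?case .
    qed
  qed
  have \<Lambda>_0: "\<Lambda> 0 = 0"
    using lim[of 0] tendsto_unique[OF _ lim[of 0], of 0] by (simp add: prob_space)
  have half_line: "\<exists>\<theta>. 0 \<le> \<theta> * p \<and> (\<forall>\<^sub>F t in at_top.
      prob {\<omega> \<in> space M. \<theta> * p \<le> \<theta> * Z t \<omega>} \<le> exp (- K / a t))" if K: "ereal K < I p" for p K
  proof -
    obtain \<theta> where \<theta>: "0 \<le> \<theta> * p" "K < \<theta> * p - \<Lambda> \<theta>" using dual[OF K] by blast
    have "\<forall>\<^sub>F t in at_top. prob {\<omega> \<in> space M. \<theta> * p \<le> \<theta> * Z t \<omega>} \<le> exp (- K / a t)"
      using tail[of 0 \<theta> p "- K"] \<theta>(2) by (simp add: Int_absorb2 Collect_subset)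
    thus ?thesis using \<theta> by blast
  qed
  have upper: "Limsup at_top (\<lambda>t. ereal (1 / (1 / a t)) * log_prob M {\<omega> \<in> space M. Z t \<omega> \<in> C})
      \<le> - (INF x\<in>C. I x)" if C: "closed C" for C
  proof -
    have main: "Limsup at_top (\<lambda>t. ereal (a t) * log_prob M {\<omega> \<in> space M. Z t \<omega> \<in> C}) \<le> ereal (- K)"
      if K: "ereal K < (INF x\<in>C. I x)" for K
    proof (cases "K < 0")
      case True
      have "\<forall>\<^sub>F t in at_top. ereal (a t) * log_prob M {\<omega> \<in> space M. Z t \<omega> \<in> C} \<le> ereal (- K)"
        using t_pos
      proof eventually_elim
        case (elim t)
        have "ereal (a t) * log_prob M {\<omega> \<in> space M. Z t \<omega> \<in> C} \<le> ereal (a t * 0)"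
          using a_pos[OF elim] by (intro log_prob_le) simp_all
        also have "\<dots> \<le> ereal (- K)" using True by simp
        finally show ?case .
      qed
      thus ?thesis by (rule Limsup_bounded)
    next
      case False
      have K_less: "ereal K < I p" if "p \<in> C" for p
        using K INF_lower[OF that, of I] by (rule less_le_trans)
      have "0 \<notin> C" using K_less[of 0] I_0 False by auto
      have pos: "\<forall>\<^sub>F t in at_top. prob {\<omega> \<in> space M. Z t \<omega> \<in> C \<inter> {0..}} \<le> exp (- K / a t)"
      proof (cases "C \<inter> {0..} = {}")
        case True
        thus ?thesis by simp
      next
        case False
        define p where "p = Inf (C \<inter> {0..})"
        have bdd: "bdd_below (C \<inter> {0..})" by (auto simp: bdd_below_def)
        have p: "p \<in> C \<inter> {0..}"
          unfolding p_def using C False bdd by (intro closed_contains_Inf) auto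
        have p_le: "p \<le> x" if "x \<in> C \<inter> {0..}" for x
          unfolding p_def using that bdd by (rule cInf_lower)
        have "0 < p" using p \<open>0 \<notin> C\<close> by (cases "p = 0") auto
        obtain \<theta> where \<theta>: "0 \<le> \<theta> * p"
          and le: "\<forall>\<^sub>F t in at_top. prob {\<omega> \<in> space M. \<theta> * p \<le> \<theta> * Z t \<omega>} \<le> exp (- K / a t)"
          using half_line[OF K_less] p by blast
        have \<theta>: "0 \<le> \<theta>" using \<theta> \<open>0 < p\<close> by (simp add: zero_le_mult_iff)
        from le t_pos show ?thesis
        proof eventually_elim
          case (elim t)
          note [measurable] = Z[OF elim(2)]
          have "prob {\<omega> \<in> space M. Z t \<omega> \<in> C \<inter> {0..}} \<le> prob {\<omega> \<in> space M. \<theta> * p \<le> \<theta> * Z t \<omega>}"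
            using p_le \<theta> by (intro finite_measure_mono) (auto intro: mult_left_mono)
          with elim show ?case by linarith
        qed
      qed
      have neg: "\<forall>\<^sub>F t in at_top. prob {\<omega> \<in> space M. Z t \<omega> \<in> C \<inter> {..0}} \<le> exp (- K / a t)"
      proof (cases "C \<inter> {..0} = {}")
        case True
        thus ?thesis by simp
      next
        case False
        define p where "p = Sup (C \<inter> {..0})"
        have bdd: "bdd_above (C \<inter> {..0})" by (auto simp: bdd_above_def)
        have p: "p \<in> C \<inter> {..0}"
          unfolding p_def using C False bdd by (intro closed_contains_Sup) auto
        have p_ge: "x \<le> p" if "x \<in> C \<inter> {..0}" for x
          unfolding p_def using that bdd by (rule cSup_upper)
        have "p < 0" using p \<open>0 \<notin> C\<close> by (cases "p = 0") auto
        obtain \<theta> where \<theta>: "0 \<le> \<theta> * p"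
          and le: "\<forall>\<^sub>F t in at_top. prob {\<omega> \<in> space M. \<theta> * p \<le> \<theta> * Z t \<omega>} \<le> exp (- K / a t)"
          using half_line[OF K_less] p by blast
        have \<theta>: "\<theta> \<le> 0" using \<theta> \<open>p < 0\<close> by (simp add: zero_le_mult_iff)
        from le t_pos show ?thesis
        proof eventually_elim
          case (elim t)
          note [measurable] = Z[OF elim(2)]
          have "prob {\<omega> \<in> space M. Z t \<omega> \<in> C \<inter> {..0}} \<le> prob {\<omega> \<in> space M. \<theta> * p \<le> \<theta> * Z t \<omega>}"
            using p_ge \<theta> by (intro finite_measure_mono) (auto intro: mult_left_mono_neg)
          with elim show ?case by linarith
        qed
      qed
      have "\<forall>\<^sub>F t in at_top. ereal (a t) * log_prob M {\<omega> \<in> space M. Z t \<omega> \<in> C} \<le> ereal (a t * ln 2 - K)"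
        using pos neg t_pos
      proof eventually_elim
        case (elim t)
        note [measurable] = Z[OF elim(3)]
        have [measurable]: "C \<in> sets borel" using C by simp
        have "prob {\<omega> \<in> space M. Z t \<omega> \<in> C}
          \<le> prob ({\<omega> \<in> space M. Z t \<omega> \<in> C \<inter> {0..}} \<union> {\<omega> \<in> space M. Z t \<omega> \<in> C \<inter> {..0}})"
          by (intro finite_measure_mono) auto
        also have "\<dots> \<le> prob {\<omega> \<in> space M. Z t \<omega> \<in> C \<inter> {0..}} + prob {\<omega> \<in> space M. Z t \<omega> \<in> C \<inter> {..0}}"
          by (intro measure_Un_le) auto
        also have "\<dots> \<le> exp (- K / a t) + exp (- K / a t)"
          using elim by (intro add_mono)
        also have "\<dots> = exp (ln 2 + - K / a t)"
          unfolding exp_add by simp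
        finally have "ereal (a t) * log_prob M {\<omega> \<in> space M. Z t \<omega> \<in> C} \<le> ereal (a t * (ln 2 + - K / a t))"
          using a_pos[OF elim(3)] by (intro log_prob_le)
        thus ?case using a_pos[OF elim(3)] by (simp add: algebra_simps)
      qed
      hence "Limsup at_top (\<lambda>t. ereal (a t) * log_prob M {\<omega> \<in> space M. Z t \<omega> \<in> C})
        \<le> Limsup at_top (\<lambda>t. ereal (a t * ln 2 - K))"
        by (rule Limsup_mono)
      also have "\<dots> = ereal (- K)"
      proof (rule lim_imp_Limsup)
        have "((\<lambda>t. a t * ln 2 - K) \<longlongrightarrow> 0 * ln 2 - K) at_top"
          by (intro tendsto_intros a_lim)
        thus "((\<lambda>t. ereal (a t * ln 2 - K)) \<longlongrightarrow> ereal (- K)) at_top" by simp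
      qed simp
      finally show ?thesis .
    qed
    let ?L = "Limsup at_top (\<lambda>t. ereal (a t) * log_prob M {\<omega> \<in> space M. Z t \<omega> \<in> C})"
    have "(INF x\<in>C. I x) \<le> - ?L"
    proof (rule dense_le)
      fix y assume y: "y < (INF x\<in>C. I x)"
      show "y \<le> - ?L"
      proof (cases y)
        case (real K)
        thus ?thesis using main[of K] y by (simp add: ereal_le_uminus_swap[of "ereal K"])
      qed (use y in auto)
    qed
    thus ?thesis by (simp add: ereal_le_uminus_swap)
  qed
  have lower: "- (INF x\<in>U. I x)
      \<le> Liminf at_top (\<lambda>t. ereal (1 / (1 / a t)) * log_prob M {\<omega> \<in> space M. Z t \<omega> \<in> U})"
    if U: "open U" for U
  proof -
    let ?L = "Liminf at_top (\<lambda>t. ereal (a t) * log_prob M {\<omega> \<in> space M. Z t \<omega> \<in> U})"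
    have "- I x \<le> ?L" if x: "x \<in> U" for x
    proof (cases "I x = \<infinity>")
      case False
      then obtain \<theta> where D: "DERIV \<Lambda> \<theta> :> x" and I_ge: "ereal (\<theta> * x - \<Lambda> \<theta>) \<le> I x"
        using exposed by blast
      obtain \<delta>0 where \<delta>0: "0 < \<delta>0" "\<And>y. \<bar>y - x\<bar> < \<delta>0 \<Longrightarrow> y \<in> U"
        using U x unfolding open_dist dist_real_def by blast
      have near: "ereal (\<Lambda> \<theta> - \<theta> * x - \<bar>\<theta>\<bar> * \<delta>) \<le> ?L" if \<delta>: "0 < \<delta>" "\<delta> \<le> \<delta>0" for \<delta>
      proof -
        have "((\<lambda>h. (\<Lambda> (\<theta> + h) - \<Lambda> \<theta>) / h) \<longlongrightarrow> x) (at 0)" using D by (simp add: DERIV_def)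
        hence "\<forall>\<^sub>F h in at 0. dist ((\<Lambda> (\<theta> + h) - \<Lambda> \<theta>) / h) x < \<delta>"
          using \<delta> by (simp add: tendsto_iff)
        then obtain d where d: "0 < d"
          and quot: "\<And>h. h \<noteq> 0 \<Longrightarrow> \<bar>h\<bar> < d \<Longrightarrow> \<bar>(\<Lambda> (\<theta> + h) - \<Lambda> \<theta>) / h - x\<bar> < \<delta>"
          by (auto simp: eventually_at dist_real_def)
        \<comment> \<open>One step \<open>h\<close> small enough for the difference quotients on both sides of \<open>\<theta>\<close> serves both tails.\<close>
        define h where "h = d / 2"
        have h: "0 < h" "h < d" using d by (auto simp: h_def)
        have right: "\<Lambda> (\<theta> + h) - h * (x + \<delta>) < \<Lambda> \<theta>"
        proof -
          have "(\<Lambda> (\<theta> + h) - \<Lambda> \<theta>) / h < x + \<delta>" using quot[of h] h by auto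
          thus ?thesis using h by (simp add: field_simps)
        qed
        have left: "\<Lambda> (\<theta> + - h) - (- h) * (x - \<delta>) < \<Lambda> \<theta>"
        proof -
          have "x - \<delta> < (\<Lambda> (\<theta> + - h) - \<Lambda> \<theta>) / (- h)" using quot[of "- h"] h by auto
          thus ?thesis using h by (simp add: field_simps)
        qed
        have small: "\<forall>\<^sub>F t in at_top.
            (\<integral>\<omega>. indicator {\<omega> \<in> space M. \<eta> * y \<le> \<eta> * Z t \<omega>} \<omega> * exp (\<theta> / a t * Z t \<omega>) \<partial>M) \<le> E \<theta> t / 4"
          if gap: "\<Lambda> (\<theta> + \<eta>) - \<eta> * y < \<Lambda> \<theta>" for \<eta> y
        proof -
          define g where "g = \<Lambda> (\<theta> + \<eta>) - \<eta> * y"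
          \<comment> \<open>Two levels strictly between \<open>g\<close> and \<open>\<Lambda> \<theta>\<close>, so that the quotient is at most \<open>exp (- (r2 - r1) / a t)\<close>.\<close>
          define r1 where "r1 = (2 * g + \<Lambda> \<theta>) / 3"
          define r2 where "r2 = (g + 2 * \<Lambda> \<theta>) / 3"
          have r: "g < r1" "r1 < r2" "r2 < \<Lambda> \<theta>" using gap by (auto simp: r1_def r2_def g_def)
          have "\<forall>\<^sub>F t in at_top. ln 4 / (r2 - r1) \<le> 1 / a t"
            using inv_a by (simp add: filterlim_at_top)
          with tail[OF r(1)[unfolded g_def]] E_ge[OF r(3)] t_pos show ?thesis
          proof eventually_elim
            case (elim t)
            have "ln 4 \<le> (r2 - r1) / a t" using elim r by (simp add: field_simps)
            hence "4 \<le> exp ((r2 - r1) / a t)" by (simp add: ln_ge_iff[symmetric] flip: ln_le_cancel_iff)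
            hence "4 * exp (r1 / a t) \<le> exp ((r2 - r1) / a t) * exp (r1 / a t)" by simp
            also have "\<dots> = exp (r2 / a t)" by (simp add: diff_divide_distrib flip: exp_add)
            finally show ?case using elim by linarith
          qed
        qed
        have "\<forall>\<^sub>F t in at_top. ereal (a t * ln (E \<theta> t) - a t * ln 2 - (\<theta> * x + \<bar>\<theta>\<bar> * \<delta>))
            \<le> ereal (a t) * log_prob M {\<omega> \<in> space M. Z t \<omega> \<in> U}"
          using small[OF right] small[OF left] int[of \<theta>] E_pos[of \<theta>] t_pos
        proof eventually_elim
          case (elim t)
          note [measurable] = Z[OF elim(5)]
          have [measurable]: "U \<in> sets borel" using U by simp
          have at: "0 < a t" using a_pos elim by simp
          define f where "f = (\<lambda>\<omega>. exp (\<theta> / a t * Z t \<omega>))"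
          define A1 where "A1 = {\<omega> \<in> space M. h * (x + \<delta>) \<le> h * Z t \<omega>}"
          define A2 where "A2 = {\<omega> \<in> space M. - h * (x - \<delta>) \<le> - h * Z t \<omega>}"
          define A3 where "A3 = {\<omega> \<in> space M. Z t \<omega> \<in> U}"
          define c where "c = exp ((\<theta> * x + \<bar>\<theta>\<bar> * \<delta>) / a t)"
          have [measurable]: "A1 \<in> sets M" "A2 \<in> sets M" "A3 \<in> sets M"
            unfolding A1_def A2_def A3_def by measurable
          have f_int [simp]: "integrable M f" unfolding f_def by fact
          have ind_int [simp]: "integrable M (\<lambda>\<omega>. indicator A \<omega> * f \<omega>)" if "A \<in> sets M" for A
            using integrable_mult_indicator[OF that f_int] by simp
          have A3_int: "integrable M (\<lambda>\<omega>. c * indicator A3 \<omega>)"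
            by (intro integrable_mult_right integrable_real_indicator) (simp_all add: less_top[symmetric])
          note ints = ind_int[of A1] ind_int[of A2] A3_int
          \<comment> \<open>\<open>A1\<close> and \<open>A2\<close> are the two tails beyond distance \<open>\<delta>\<close>; off both of them \<open>Z t\<close> lies in \<open>U\<close> and \<open>f \<le> c\<close>.\<close>
          have "E \<theta> t \<le> (\<integral>\<omega>. indicator A1 \<omega> * f \<omega> + indicator A2 \<omega> * f \<omega> + c * indicator A3 \<omega> \<partial>M)"
            unfolding E_def f_def[symmetric]
          proof (rule integral_mono)
            fix \<omega> assume \<omega>: "\<omega> \<in> space M"
            have c_nn: "0 \<le> c * indicator A3 \<omega>" by (simp add: c_def)
            have f_nn: "0 \<le> indicator A \<omega> * f \<omega>" for A by (simp add: f_def)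
            consider "\<omega> \<in> A1" | "\<omega> \<in> A2" | "\<omega> \<notin> A1" "\<omega> \<notin> A2" by blast
            thus "f \<omega> \<le> indicator A1 \<omega> * f \<omega> + indicator A2 \<omega> * f \<omega> + c * indicator A3 \<omega>"
            proof cases
              case 1
              thus ?thesis using c_nn f_nn[of A2] by simp
            next
              case 2
              thus ?thesis using c_nn f_nn[of A1] by simp
            next
              case 3
              hence Zx: "\<bar>Z t \<omega> - x\<bar> < \<delta>"
                using \<omega> h by (auto simp: A1_def A2_def)
              hence "\<omega> \<in> A3" using \<omega> \<delta>0(2) \<delta>(2) by (auto simp: A3_def)
              moreover have "f \<omega> \<le> c"
              proof -
                have "\<theta> * (Z t \<omega> - x) \<le> \<bar>\<theta>\<bar> * \<delta>"
                  using Zx by (metis abs_ge_self abs_ge_zero abs_mult less_imp_le mult_left_mono order_trans)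
                hence "\<theta> * Z t \<omega> \<le> \<theta> * x + \<bar>\<theta>\<bar> * \<delta>" by (simp add: algebra_simps)
                thus ?thesis using at by (simp add: f_def c_def divide_right_mono)
              qed
              ultimately show ?thesis using f_nn[of A1] f_nn[of A2] by simp
            qed
          qed (use ints in auto)
          also have "\<dots> = (\<integral>\<omega>. indicator A1 \<omega> * f \<omega> \<partial>M) + (\<integral>\<omega>. indicator A2 \<omega> * f \<omega> \<partial>M) + c * prob A3"
            using ints by simp
          also have "\<dots> \<le> E \<theta> t / 4 + E \<theta> t / 4 + c * prob A3"
            using elim(1,2) unfolding A1_def A2_def f_def by (intro add_mono) auto
          finally have "E \<theta> t / 2 \<le> c * prob A3" by simp
          moreover have "E \<theta> t / 2 = exp (ln (E \<theta> t) - ln 2)"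
            using elim by (simp add: exp_diff)
          ultimately have "exp (ln (E \<theta> t) - ln 2 - (\<theta> * x + \<bar>\<theta>\<bar> * \<delta>) / a t) \<le> prob A3"
            unfolding exp_diff[of "ln (E \<theta> t) - ln 2"] c_def[symmetric]
            by (simp add: c_def pos_divide_le_eq mult.commute)
          hence "ereal (a t * (ln (E \<theta> t) - ln 2 - (\<theta> * x + \<bar>\<theta>\<bar> * \<delta>) / a t)) \<le> ereal (a t) * log_prob M A3"
            using at by (intro log_prob_ge)
          moreover have "a t * (ln (E \<theta> t) - ln 2 - (\<theta> * x + \<bar>\<theta>\<bar> * \<delta>) / a t)
            = a t * ln (E \<theta> t) - a t * ln 2 - (\<theta> * x + \<bar>\<theta>\<bar> * \<delta>)"
            unfolding right_diff_distrib using at by simp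
          ultimately show ?case by (simp only: A3_def)
        qed
        hence "Liminf at_top (\<lambda>t. ereal (a t * ln (E \<theta> t) - a t * ln 2 - (\<theta> * x + \<bar>\<theta>\<bar> * \<delta>))) \<le> ?L"
          by (rule Liminf_mono)
        moreover have "Liminf at_top (\<lambda>t. ereal (a t * ln (E \<theta> t) - a t * ln 2 - (\<theta> * x + \<bar>\<theta>\<bar> * \<delta>)))
          = ereal (\<Lambda> \<theta> - \<theta> * x - \<bar>\<theta>\<bar> * \<delta>)"
        proof (rule lim_imp_Liminf)
          have "((\<lambda>t. a t * ln (E \<theta> t) - a t * ln 2 - (\<theta> * x + \<bar>\<theta>\<bar> * \<delta>))
            \<longlongrightarrow> \<Lambda> \<theta> - 0 * ln 2 - (\<theta> * x + \<bar>\<theta>\<bar> * \<delta>)) at_top"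
            unfolding E_def by (intro tendsto_intros lim a_lim)
          thus "((\<lambda>t. ereal (a t * ln (E \<theta> t) - a t * ln 2 - (\<theta> * x + \<bar>\<theta>\<bar> * \<delta>)))
            \<longlongrightarrow> ereal (\<Lambda> \<theta> - \<theta> * x - \<bar>\<theta>\<bar> * \<delta>)) at_top" by (simp add: algebra_simps)
        qed simp
        ultimately show ?thesis by simp
      qed
      have "- I x \<le> - ereal (\<theta> * x - \<Lambda> \<theta>)" using I_ge by (simp only: ereal_minus_le_minus)
      also have "\<dots> = ereal (\<Lambda> \<theta> - \<theta> * x)" by simp
      also have "\<dots> \<le> ?L"
      proof (rule ereal_le_epsilon2)
          fix e :: real assume e: "0 < e"
          define \<delta> where "\<delta> = min \<delta>0 (e / (\<bar>\<theta>\<bar> + 1))"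
          have \<delta>: "0 < \<delta>" "\<delta> \<le> \<delta>0" using e \<delta>0 by (auto simp: \<delta>_def)
          have "\<bar>\<theta>\<bar> * \<delta> \<le> (\<bar>\<theta>\<bar> + 1) * (e / (\<bar>\<theta>\<bar> + 1))"
            using \<delta> by (intro mult_mono) (auto simp: \<delta>_def)
          also have "\<dots> = e" by (simp add: field_simps)
          finally have "\<bar>\<theta>\<bar> * \<delta> \<le> e" .
          hence "ereal (\<Lambda> \<theta> - \<theta> * x) \<le> ereal (\<Lambda> \<theta> - \<theta> * x - \<bar>\<theta>\<bar> * \<delta>) + ereal e" by simp
          also have "\<dots> \<le> ?L + ereal e" using near[OF \<delta>] by (intro add_right_mono)
          finally show "ereal (\<Lambda> \<theta> - \<theta> * x) \<le> ?L + ereal e" .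
      qed
      finally show ?thesis .
    qed simp
    hence "- ?L \<le> (INF x\<in>U. I x)"
      by (intro INF_greatest) (simp add: ereal_uminus_le_reorder)
    thus ?thesis by (simp add: ereal_uminus_le_reorder)
  qed
  show ?thesis
    unfolding LDP_def using Z inv_a rate upper lower by blast
qed

end

section \<open>Exponential moments of a Levy process on a grid\<close>

context prob_space
begin

lemma indep_var_nn_integral_mult:
  fixes X :: "'a \<Rightarrow> 'b" and f g :: "_ \<Rightarrow> ennreal"
  assumes "indep_var N1 X N2 Y" and [measurable]: "f \<in> borel_measurable N1" "g \<in> borel_measurable N2"
  shows "(\<integral>\<^sup>+\<omega>. f (X \<omega>) * g (Y \<omega>) \<partial>M) = (\<integral>\<^sup>+\<omega>. f (X \<omega>) \<partial>M) * (\<integral>\<^sup>+\<omega>. g (Y \<omega>) \<partial>M)"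
proof -
  have "indep_var borel (f \<circ> X) borel (g \<circ> Y)"
    using assms by (intro indep_var_compose[OF assms(1)]) simp_all
  moreover have "case_bool borel borel = (\<lambda>_::bool. borel :: ennreal measure)"
    by (auto simp: fun_eq_iff split: bool.split)
  ultimately have "indep_vars (\<lambda>_. borel) (case_bool (f \<circ> X) (g \<circ> Y)) UNIV"
    by (simp add: indep_var_def)
  from indep_vars_nn_integral[OF _ this] show ?thesis by (simp add: UNIV_bool mult.commute comp_def)
qed

text \<open>
  The Markov property at a fixed time, for nonnegative functions, so that exponentials and indicators can be
  inserted without integrability conditions.
\<close>

lemma levy_increment_nn_integral_mult:
  fixes f g :: "real \<Rightarrow> ennreal"
  assumes X: "levy_process M X" and u: "0 \<le> u" and v: "0 < v"
    and [measurable]: "f \<in> borel_measurable borel" "g \<in> borel_measurable borel"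
  shows "(\<integral>\<^sup>+\<omega>. f (X u \<omega>) * g (X (u + v) \<omega> - X u \<omega>) \<partial>M)
    = (\<integral>\<^sup>+\<omega>. f (X u \<omega>) \<partial>M) * (\<integral>\<^sup>+\<omega>. g (X v \<omega>) \<partial>M)"
\<comment> \<open>At \<open>u = 0\<close> the times \<open>0, u, u + v\<close> are not strictly increasing, so independence of increments says nothing.\<close>
proof (cases "u = 0")
  case True
  have X0: "AE \<omega> in M. X 0 \<omega> = 0" using X by (simp add: levy_process_def)
  have [measurable]: "X v \<in> borel_measurable M" using X v by (simp add: levy_process_def)
  have "(\<integral>\<^sup>+\<omega>. f (X u \<omega>) * g (X (u + v) \<omega> - X u \<omega>) \<partial>M) = (\<integral>\<^sup>+\<omega>. f 0 * g (X v \<omega>) \<partial>M)"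
    using X0 True by (intro nn_integral_cong_AE) auto
  also have "\<dots> = f 0 * (\<integral>\<^sup>+\<omega>. g (X v \<omega>) \<partial>M)" by (intro nn_integral_cmult) measurable
  also have "f 0 = (\<integral>\<^sup>+\<omega>. f 0 \<partial>M)" by (simp add: emeasure_space_1)
  also have "\<dots> = (\<integral>\<^sup>+\<omega>. f (X u \<omega>) \<partial>M)"
    using X0 True by (intro nn_integral_cong_AE) auto
  finally show ?thesis .
next
  case False
  hence u: "0 < u" using u by simp
  have X0: "AE \<omega> in M. X 0 \<omega> = 0" using X by (simp add: levy_process_def)
  have [measurable]: "X t \<in> borel_measurable M" if "0 \<le> t" for t
    using X that by (simp add: levy_process_def)
  define s where "s i = (if i = 0 then 0 else if i = 1 then u else u + v)" for i :: nat
  have s: "0 \<le> s 0" "\<forall>i<2. s i < s (Suc i)"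
    using u v by (auto simp: s_def less_2_cases_iff)
  have "indep_vars (\<lambda>_. borel) (\<lambda>i \<omega>. X (s (Suc i)) \<omega> - X (s i) \<omega>) {..<2}"
    using X s unfolding levy_process_def independent_increments_def by blast
  hence "indep_vars (\<lambda>_. borel)
      (\<lambda>i \<omega>. (if i = 0 then f else g) (X (s (Suc i)) \<omega> - X (s i) \<omega>)) {..<2}"
    by (rule indep_vars_compose2) simp
  from indep_vars_nn_integral[OF _ this]
  have indep: "(\<integral>\<^sup>+\<omega>. f (X u \<omega> - X 0 \<omega>) * g (X (u + v) \<omega> - X u \<omega>) \<partial>M)
    = (\<integral>\<^sup>+\<omega>. f (X u \<omega> - X 0 \<omega>) \<partial>M) * (\<integral>\<^sup>+\<omega>. g (X (u + v) \<omega> - X u \<omega>) \<partial>M)"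
    by (simp add: s_def numeral_2_eq_2 lessThan_Suc mult.commute)
  have "(\<integral>\<^sup>+\<omega>. f (X u \<omega>) * g (X (u + v) \<omega> - X u \<omega>) \<partial>M)
    = (\<integral>\<^sup>+\<omega>. f (X u \<omega> - X 0 \<omega>) * g (X (u + v) \<omega> - X u \<omega>) \<partial>M)"
    using X0 by (intro nn_integral_cong_AE) auto
  also have "\<dots> = (\<integral>\<^sup>+\<omega>. f (X u \<omega> - X 0 \<omega>) \<partial>M) * (\<integral>\<^sup>+\<omega>. g (X (u + v) \<omega> - X u \<omega>) \<partial>M)"
    by (rule indep)
  also have "(\<integral>\<^sup>+\<omega>. f (X u \<omega> - X 0 \<omega>) \<partial>M) = (\<integral>\<^sup>+\<omega>. f (X u \<omega>) \<partial>M)"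
    using X0 by (intro nn_integral_cong_AE) auto
  also have "(\<integral>\<^sup>+\<omega>. g (X (u + v) \<omega> - X u \<omega>) \<partial>M) = (\<integral>\<^sup>+x. g x \<partial>distr M borel (\<lambda>\<omega>. X (u + v) \<omega> - X u \<omega>))"
    using u v by (subst nn_integral_distr) auto
  also have "distr M borel (\<lambda>\<omega>. X (u + v) \<omega> - X u \<omega>) = distr M borel (X v)"
    using X u v by (simp add: levy_process_def stationary_increments_def)
  also have "(\<integral>\<^sup>+x. g x \<partial>distr M borel (X v)) = (\<integral>\<^sup>+\<omega>. g (X v \<omega>) \<partial>M)"
    using u v by (subst nn_integral_distr) auto
  finally show ?thesis .
qed

text \<open>
  Stationary independent increments make the moment multiplicative along the grid of mesh \<open>2 ^ - n\<close>, and the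
  value over one step is the \<open>2 ^ n\<close>-th root of the value at time \<open>1\<close>. Dyadic times suffice, as random
  times are approximated by dyadic ones later.
\<close>

lemma levy_exp_moment_grid:
  assumes X: "levy_process M X" and int: "integrable M (\<lambda>\<omega>. exp (\<theta> * X 1 \<omega>))"
  shows "(\<integral>\<^sup>+\<omega>. exp (\<theta> * X (real k / 2 ^ n) \<omega>) \<partial>M) = ennreal (exp (cgf M (X 1) \<theta> * (real k / 2 ^ n)))"
proof -
  define \<phi> where "\<phi> u = (\<integral>\<^sup>+\<omega>. exp (\<theta> * X u \<omega>) \<partial>M)" for u
  define \<delta> :: real where "\<delta> = 1 / 2 ^ n"
  have \<delta>: "0 < \<delta>" by (simp add: \<delta>_def)
  have add: "\<phi> (u + \<delta>) = \<phi> u * \<phi> \<delta>" if "0 \<le> u" for u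
  proof -
    have "\<phi> (u + \<delta>) = (\<integral>\<^sup>+\<omega>. ennreal (exp (\<theta> * X u \<omega>)) * ennreal (exp (\<theta> * (X (u + \<delta>) \<omega> - X u \<omega>))) \<partial>M)"
      unfolding \<phi>_def by (simp add: algebra_simps flip: ennreal_mult exp_add)
    also have "\<dots> = \<phi> u * \<phi> \<delta>"
      unfolding \<phi>_def using that \<delta>
      by (intro levy_increment_nn_integral_mult[OF X, where f="\<lambda>x. ennreal (exp (\<theta> * x))"
            and g="\<lambda>x. ennreal (exp (\<theta> * x))"]) auto
    finally show ?thesis .
  qed
  have pow: "\<phi> (real k * \<delta>) = \<phi> \<delta> ^ k" for k
  proof (induction k)
    case 0
    have "\<phi> 0 = (\<integral>\<^sup>+\<omega>. 1 \<partial>M)"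
      unfolding \<phi>_def using X by (intro nn_integral_cong_AE) (auto simp: levy_process_def)
    thus ?case by (simp add: emeasure_space_1)
  next
    case (Suc k)
    thus ?case using add[of "real k * \<delta>"] \<delta> by (simp add: algebra_simps)
  qed
  have "\<phi> 1 = ennreal (expectation (\<lambda>\<omega>. exp (\<theta> * X 1 \<omega>)))"
    unfolding \<phi>_def using int by (intro nn_integral_eq_integral) auto
  also have "\<dots> = ennreal (exp (cgf M (X 1) \<theta>))"
    using expectation_exp_pos[OF int] by (simp add: cgf_def)
  finally have "\<phi> \<delta> ^ (2 ^ n) = ennreal (exp (cgf M (X 1) \<theta>))"
    using pow[of "2 ^ n"] by (simp add: \<delta>_def)
  moreover from this have "\<phi> \<delta> \<noteq> \<top>" by (auto simp: top_power_ennreal)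
  ultimately obtain y where y: "0 \<le> y" "\<phi> \<delta> = ennreal y" "y ^ (2 ^ n) = exp (cgf M (X 1) \<theta>)"
    by (cases "\<phi> \<delta>") (auto simp: ennreal_power)
  have "exp (cgf M (X 1) \<theta> * \<delta>) ^ (2 ^ n) = exp (cgf M (X 1) \<theta>)"
    by (simp add: \<delta>_def flip: exp_of_nat_mult)
  hence "y = exp (cgf M (X 1) \<theta> * \<delta>)"
    using y by (intro power_eq_imp_eq_base[of y "2 ^ n"]) auto
  hence "\<phi> (real k * \<delta>) = ennreal (exp (cgf M (X 1) \<theta> * \<delta>) ^ k)"
    using pow[of k] y by (simp add: ennreal_power)
  thus ?thesis by (simp add: \<phi>_def \<delta>_def mult.commute flip: exp_of_nat_mult)
qed

end

section \<open>Exponential moments of the inverse stable subordinator\<close>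

context prob_space
begin

text \<open>
  Here \<open>\<xi>\<close> is chosen with \<open>\<xi> powr \<nu> = (1 + e) l\<close>. If \<open>L\<^sub>t\<close> exceeds the grid point \<open>u = n / l\<close>, then \<open>H u \<le> t\<close>, so that
  the indicator of this event is at most \<open>exp (\<xi> (t - H u))\<close>, whose expectation is \<open>exp (\<xi> t - n (1 + e))\<close>.
  Summing \<open>exp (n + 1)\<close> times these bounds gives a geometric series with ratio \<open>exp (- e)\<close>. The mesh \<open>1 / l\<close>
  makes the constant independent of \<open>l\<close> and \<open>t\<close>.
\<close>

lemma inverse_subordinator_mgf_upper:
  assumes \<nu>: "0 < \<nu>" and L: "inverse_stable_subordinator M \<nu> L"
    and t: "0 \<le> t" and l: "0 \<le> l" and e: "0 < e"
  shows "(\<integral>\<^sup>+\<omega>. exp (l * L t \<omega>) \<partial>M)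
    \<le> ennreal (exp (1 + ((1 + e) * l) powr (1 / \<nu>) * t) / (1 - exp (- e)))"
proof (cases "l = 0")
  case True
  have "1 \<le> exp 1 / (1 - exp (- e))"
    using e by (simp add: pos_le_divide_eq) (smt (verit) exp_gt_zero one_le_exp_iff)
  thus ?thesis using True by (simp add: emeasure_space_1)
next
  case False
  hence l: "0 < l" using l by simp
  obtain H where H: "stable_subordinator M \<nu> H"
    and L_eq: "AE \<omega> in M. \<forall>t\<ge>0. L t \<omega> = Inf {u. 0 \<le> u \<and> t < H u \<omega>}"
    using L unfolding inverse_stable_subordinator_def by blast
  have H_meas [measurable]: "H u \<in> borel_measurable M" if "0 \<le> u" for u
    using H that by (simp add: stable_subordinator_def levy_process_def)
  have H_0: "AE \<omega> in M. H 0 \<omega> = 0"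
    using H by (simp add: stable_subordinator_def levy_process_def)
  define \<xi> where "\<xi> = ((1 + e) * l) powr (1 / \<nu>)"
  have \<xi>: "0 \<le> \<xi>" "\<xi> powr \<nu> = (1 + e) * l"
    using \<nu> l e by (auto simp: \<xi>_def powr_powr)
  define g where "g n \<omega> = ennreal (exp (real n + 1 + \<xi> * t) * exp (- \<xi> * H (real n / l) \<omega>))" for n \<omega>
  have [measurable]: "H (real n / l) \<in> borel_measurable M" for n
    using l by (intro H_meas) simp
  have g_meas [measurable]: "g n \<in> borel_measurable M" for n
    unfolding g_def by measurable
  have "AE \<omega> in M. ennreal (exp (l * L t \<omega>)) \<le> (\<Sum>n. g n \<omega>)"
    using L_eq H_0
  proof eventually_elim
    case (elim \<omega>)
    \<comment> \<open>The last grid point strictly below \<open>L\<^sub>t\<close>, or \<open>0\<close> if \<open>L\<^sub>t = 0\<close>; in the latter case \<open>H 0 = 0 \<le> t\<close>.\<close>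
    define n where "n = nat (\<lceil>l * L t \<omega>\<rceil> - 1)"
    have upper: "l * L t \<omega> \<le> real n + 1"
      unfolding n_def by linarith
    have "H (real n / l) \<omega> \<le> t"
    proof (cases "n = 0")
      case True
      thus ?thesis using elim t by simp
    next
      case False
      hence "real n < l * L t \<omega>" unfolding n_def by linarith
      hence less: "real n / l < L t \<omega>" using l by (simp add: field_simps)
      show ?thesis
      proof (rule ccontr)
        assume "\<not> H (real n / l) \<omega> \<le> t"
        hence "L t \<omega> \<le> real n / l"
          using elim t l by (auto intro!: cInf_lower simp: bdd_below_def)
        with less show False by simp
      qed
    qed
    hence "\<xi> * H (real n / l) \<omega> \<le> \<xi> * t" using \<xi> by (intro mult_left_mono)
    hence "ennreal (exp (l * L t \<omega>)) \<le> g n \<omega>"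
      unfolding g_def using upper by (intro ennreal_leI) (simp flip: exp_add)
    also have "\<dots> \<le> (\<Sum>n. g n \<omega>)"
      using sum_le_suminf[of "\<lambda>n. g n \<omega>" "{n}"] by simp
    finally show ?case .
  qed
  hence "(\<integral>\<^sup>+\<omega>. exp (l * L t \<omega>) \<partial>M) \<le> (\<integral>\<^sup>+\<omega>. (\<Sum>n. g n \<omega>) \<partial>M)"
    by (rule nn_integral_mono_AE)
  also have "\<dots> = (\<Sum>n. \<integral>\<^sup>+\<omega>. g n \<omega> \<partial>M)"
    by (intro nn_integral_suminf) simp
  also have "(\<lambda>n. \<integral>\<^sup>+\<omega>. g n \<omega> \<partial>M) = (\<lambda>n. ennreal (exp (1 + \<xi> * t) * exp (- e) ^ n))"
  proof
    fix n
    have LT: "integrable M (\<lambda>\<omega>. exp (- \<xi> * H (real n / l) \<omega>))"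
      "expectation (\<lambda>\<omega>. exp (- \<xi> * H (real n / l) \<omega>)) = exp (- (real n / l) * \<xi> powr \<nu>)"
      using H \<xi>(1) l unfolding stable_subordinator_def by auto
    have "(\<integral>\<^sup>+\<omega>. g n \<omega> \<partial>M) = ennreal (\<integral>\<omega>. exp (real n + 1 + \<xi> * t) * exp (- \<xi> * H (real n / l) \<omega>) \<partial>M)"
      unfolding g_def using LT(1) by (intro nn_integral_eq_integral) auto
    also have "(\<integral>\<omega>. exp (real n + 1 + \<xi> * t) * exp (- \<xi> * H (real n / l) \<omega>) \<partial>M)
      = exp (real n + 1 + \<xi> * t) * exp (- (real n / l) * \<xi> powr \<nu>)"
      using LT by simp
    also have "\<dots> = exp (1 + \<xi> * t) * exp (- e) ^ n"
      using \<xi> l by (simp add: field_simps flip: exp_add exp_of_nat_mult)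
    finally show "(\<integral>\<^sup>+\<omega>. g n \<omega> \<partial>M) = ennreal (exp (1 + \<xi> * t) * exp (- e) ^ n)" .
  qed
  also have "(\<Sum>n. ennreal (exp (1 + \<xi> * t) * exp (- e) ^ n)) = ennreal (exp (1 + \<xi> * t) * (1 / (1 - exp (- e))))"
    using e by (intro suminf_ennreal_eq sums_mult geometric_sums) auto
  finally show ?thesis by (simp add: \<xi>_def)
qed

lemma inverse_subordinator_mgf_integrable:
  assumes \<nu>: "0 < \<nu>" and L: "inverse_stable_subordinator M \<nu> L" and t: "0 \<le> t"
  shows "integrable M (\<lambda>\<omega>. exp (l * L t \<omega>))"
proof -
  have [measurable]: "L t \<in> borel_measurable M" and L_nn: "\<And>\<omega>. \<omega> \<in> space M \<Longrightarrow> 0 \<le> L t \<omega>"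
    using L t by (auto simp: inverse_stable_subordinator_def)
  have "(\<integral>\<^sup>+\<omega>. exp (\<bar>l\<bar> * L t \<omega>) \<partial>M) < \<infinity>"
    using inverse_subordinator_mgf_upper[OF \<nu> L t, of "\<bar>l\<bar>" 1] by (simp add: less_top le_less_trans)
  hence "integrable M (\<lambda>\<omega>. exp (\<bar>l\<bar> * L t \<omega>))"
    by (intro integrableI_nonneg) auto
  thus ?thesis
    by (rule Bochner_Integration.integrable_bound) (auto intro!: AE_I2 mult_right_mono L_nn)
qed

text \<open>
  Optional stopping for the martingale \<open>exp (l u - \<xi> H u)\<close>, where \<open>\<xi> powr \<nu> = l\<close>, along a grid of mesh \<open>\<delta>\<close>. The
  first grid time at which \<open>H\<close> exceeds \<open>t\<close> is at most \<open>L\<^sub>t + \<delta>\<close>, and there \<open>\<xi> H \<ge> \<xi> t\<close>; hence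
  \<open>1 \<le> exp (l \<delta> - \<xi> t) E exp (l L\<^sub>t)\<close>, and \<open>\<delta>\<close> tends to \<open>0\<close>. Since \<open>H\<close> is increasing, the event
  that \<open>H\<close> has not yet passed \<open>t\<close> depends only on the current value of \<open>H\<close>, so that the stopping theorem reduces to
  a telescoping sum.
\<close>

lemma inverse_subordinator_mgf_lower:
  assumes \<nu>: "0 < \<nu>" and L: "inverse_stable_subordinator M \<nu> L" and t: "0 \<le> t" and l: "0 \<le> l"
  shows "exp (l powr (1 / \<nu>) * t) \<le> expectation (\<lambda>\<omega>. exp (l * L t \<omega>))"
proof (cases "l = 0")
  case True
  thus ?thesis by (simp add: prob_space)
next
  case False
  hence l: "0 < l" using l by simp
  obtain H where H: "stable_subordinator M \<nu> H"
    and L_eq: "AE \<omega> in M. \<forall>t\<ge>0. L t \<omega> = Inf {u. 0 \<le> u \<and> t < H u \<omega>}"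
    using L unfolding inverse_stable_subordinator_def by blast
  have H_levy: "levy_process M H" using H by (simp add: stable_subordinator_def)
  have H_meas [measurable]: "H u \<in> borel_measurable M" if "0 \<le> u" for u
    using H_levy that by (simp add: levy_process_def)
  have H_0: "AE \<omega> in M. H 0 \<omega> = 0"
    using H_levy by (simp add: levy_process_def)
  have H_mono: "AE \<omega> in M. mono_on {0..} (\<lambda>u. H u \<omega>)"
    using H by (simp add: stable_subordinator_def)
  have [measurable]: "L t \<in> borel_measurable M"
    using L t by (auto simp: inverse_stable_subordinator_def)
  have LT: "(\<integral>\<^sup>+\<omega>. exp (c - \<xi> * H u \<omega>) \<partial>M) = ennreal (exp (c - u * \<xi> powr \<nu>))"
    if "0 \<le> \<xi>" "0 \<le> u" for \<xi> u c
  proof -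
    have int: "integrable M (\<lambda>\<omega>. exp (- \<xi> * H u \<omega>))"
      and eq: "expectation (\<lambda>\<omega>. exp (- \<xi> * H u \<omega>)) = exp (- u * \<xi> powr \<nu>)"
      using H that by (auto simp: stable_subordinator_def)
    have "(\<integral>\<^sup>+\<omega>. exp (c - \<xi> * H u \<omega>) \<partial>M) = (\<integral>\<^sup>+\<omega>. exp c * exp (- \<xi> * H u \<omega>) \<partial>M)"
      by (simp flip: exp_add)
    also have "\<dots> = ennreal (exp c * exp (- u * \<xi> powr \<nu>))"
      using int eq by (subst nn_integral_eq_integral) auto
    finally show ?thesis by (simp flip: exp_add)
  qed
  define \<xi> where "\<xi> = l powr (1 / \<nu>)"
  have \<xi>: "0 \<le> \<xi>" "\<xi> powr \<nu> = l" using \<nu> l by (auto simp: \<xi>_def powr_powr)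
  \<comment> \<open>Any exponent larger than \<open>\<xi>\<close> shows that the mass that is never stopped vanishes.\<close>
  define \<zeta> where "\<zeta> = (2 * l) powr (1 / \<nu>)"
  have \<zeta>: "0 \<le> \<zeta>" "\<zeta> powr \<nu> = 2 * l" using \<nu> l by (auto simp: \<zeta>_def powr_powr)
  define F where "F = expectation (\<lambda>\<omega>. exp (l * L t \<omega>))"
  have F_int: "integrable M (\<lambda>\<omega>. exp (l * L t \<omega>))"
    by (rule inverse_subordinator_mgf_integrable[OF \<nu> L t])
  have F_nn: "0 \<le> F" by (simp add: F_def)
  have grid: "exp (\<xi> * t) \<le> exp (l * \<delta>) * F" if \<delta>: "0 < \<delta>" for \<delta>
  proof -
    define h where "h n = H (real n * \<delta>)" for n
    have [measurable]: "h n \<in> borel_measurable M" for n using \<delta> by (simp add: h_def)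
    \<comment> \<open>\<open>A n\<close> is the mass of the martingale not stopped by step \<open>n\<close>, \<open>B n\<close> the mass stopped at step \<open>n + 1\<close>.\<close>
    define A where "A n = (\<integral>\<^sup>+\<omega>. indicator {..t} (h n \<omega>) * ennreal (exp (l * (real n * \<delta>) - \<xi> * h n \<omega>)) \<partial>M)" for n
    define B where "B n = (\<integral>\<^sup>+\<omega>. indicator {..t} (h n \<omega>) * indicator {t<..} (h (Suc n) \<omega>)
      * ennreal (exp (l * (real (Suc n) * \<delta>) - \<xi> * h (Suc n) \<omega>)) \<partial>M)" for n
    have A_0: "A 0 = 1"
    proof -
      have "A 0 = (\<integral>\<^sup>+\<omega>. 1 \<partial>M)"
        unfolding A_def h_def using H_0 t by (intro nn_integral_cong_AE) auto
      thus ?thesis by (simp add: emeasure_space_1)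
    qed
    have A_Suc: "A n = B n + A (Suc n)" for n
    proof -
      have "A n = A n * (\<integral>\<^sup>+\<omega>. exp (l * \<delta> - \<xi> * H \<delta> \<omega>) \<partial>M)"
        using LT[of \<xi> \<delta> "l * \<delta>"] \<xi> \<delta> by simp
      also have "\<dots> = (\<integral>\<^sup>+\<omega>. indicator {..t} (h n \<omega>) * ennreal (exp (l * (real n * \<delta>) - \<xi> * h n \<omega>))
        * ennreal (exp (l * \<delta> - \<xi> * (H (real n * \<delta> + \<delta>) \<omega> - h n \<omega>))) \<partial>M)"
        unfolding A_def h_def using \<delta>
        by (intro levy_increment_nn_integral_mult[OF H_levy, symmetric,
            where f="\<lambda>x. indicator {..t} x * ennreal (exp (l * (real n * \<delta>) - \<xi> * x))"
              and g="\<lambda>x. ennreal (exp (l * \<delta> - \<xi> * x))"]) auto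
      also have "\<dots> = (\<integral>\<^sup>+\<omega>. indicator {..t} (h n \<omega>)
          * ennreal (exp (l * (real (Suc n) * \<delta>) - \<xi> * h (Suc n) \<omega>)) \<partial>M)"
        by (simp add: h_def algebra_simps flip: ennreal_mult exp_add)
      also have "\<dots> = (\<integral>\<^sup>+\<omega>. indicator {..t} (h n \<omega>) * indicator {t<..} (h (Suc n) \<omega>)
          * ennreal (exp (l * (real (Suc n) * \<delta>) - \<xi> * h (Suc n) \<omega>))
        + indicator {..t} (h (Suc n) \<omega>) * ennreal (exp (l * (real (Suc n) * \<delta>) - \<xi> * h (Suc n) \<omega>)) \<partial>M)"
      proof (rule nn_integral_cong_AE)
        show "AE \<omega> in M. indicator {..t} (h n \<omega>) * ennreal (exp (l * (real (Suc n) * \<delta>) - \<xi> * h (Suc n) \<omega>))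
          = indicator {..t} (h n \<omega>) * indicator {t<..} (h (Suc n) \<omega>)
            * ennreal (exp (l * (real (Suc n) * \<delta>) - \<xi> * h (Suc n) \<omega>))
          + indicator {..t} (h (Suc n) \<omega>) * ennreal (exp (l * (real (Suc n) * \<delta>) - \<xi> * h (Suc n) \<omega>))"
          using H_mono
        proof eventually_elim
          case (elim \<omega>)
          have "h n \<omega> \<le> h (Suc n) \<omega>"
            unfolding h_def using elim \<delta> by (auto simp: mono_on_def)
          thus ?case by (auto simp: indicator_def)
        qed
      qed
      also have "\<dots> = B n + A (Suc n)"
        unfolding A_def B_def by (intro nn_integral_add) measurable
      finally show ?thesis .
    qed
    have telescope: "(\<Sum>n<N. B n) + A N = 1" for N
    proof (induction N)
      case (Suc N)
      thus ?case unfolding A_Suc[of N] by (simp add: add.assoc)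
    qed (simp add: A_0)
    have B_le: "(\<Sum>n<N. B n) \<le> ennreal (exp (l * \<delta> - \<xi> * t) * F)" for N
    proof -
      have "(\<Sum>n<N. B n) = (\<integral>\<^sup>+\<omega>. (\<Sum>n<N. indicator {..t} (h n \<omega>) * indicator {t<..} (h (Suc n) \<omega>)
          * ennreal (exp (l * (real (Suc n) * \<delta>) - \<xi> * h (Suc n) \<omega>))) \<partial>M)"
        unfolding B_def by (intro nn_integral_sum[symmetric]) measurable
      also have "\<dots> \<le> (\<integral>\<^sup>+\<omega>. ennreal (exp (l * \<delta> - \<xi> * t) * exp (l * L t \<omega>)) \<partial>M)"
      proof (rule nn_integral_mono_AE)
        show "AE \<omega> in M. (\<Sum>n<N. indicator {..t} (h n \<omega>) * indicator {t<..} (h (Suc n) \<omega>)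
            * ennreal (exp (l * (real (Suc n) * \<delta>) - \<xi> * h (Suc n) \<omega>)))
          \<le> ennreal (exp (l * \<delta> - \<xi> * t) * exp (l * L t \<omega>))"
          using H_mono L_eq
        proof eventually_elim
          case (elim \<omega>)
          have h_mono: "h i \<omega> \<le> h j \<omega>" if "i \<le> j" for i j
            unfolding h_def using elim(1) \<delta> that by (auto simp: mono_on_def mult_right_mono)
          show ?case
          proof (cases "\<exists>n<N. h n \<omega> \<le> t \<and> t < h (Suc n) \<omega>")
            case True
            then obtain n where n: "n < N" "h n \<omega> \<le> t" "t < h (Suc n) \<omega>" by blast
            have other: "\<not> (h k \<omega> \<le> t \<and> t < h (Suc k) \<omega>)" if "k \<noteq> n" for k
              using that n h_mono[of "Suc k" n] h_mono[of "Suc n" k] by (cases k n rule: linorder_cases) auto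
            have "(\<Sum>k<N. indicator {..t} (h k \<omega>) * indicator {t<..} (h (Suc k) \<omega>)
                * ennreal (exp (l * (real (Suc k) * \<delta>) - \<xi> * h (Suc k) \<omega>)))
              = (\<Sum>k\<in>{n}. indicator {..t} (h k \<omega>) * indicator {t<..} (h (Suc k) \<omega>)
                * ennreal (exp (l * (real (Suc k) * \<delta>) - \<xi> * h (Suc k) \<omega>)))"
              using n(1) other by (intro sum.mono_neutral_right) (auto simp: indicator_def)
            also have "\<dots> = ennreal (exp (l * (real (Suc n) * \<delta>) - \<xi> * h (Suc n) \<omega>))"
              using n by simp
            also have "\<dots> \<le> ennreal (exp (l * \<delta> - \<xi> * t) * exp (l * L t \<omega>))"
            proof (rule ennreal_leI)
              have "real n * \<delta> \<le> Inf {u. 0 \<le> u \<and> t < H u \<omega>}"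
              proof (rule cInf_greatest)
                show "{u. 0 \<le> u \<and> t < H u \<omega>} \<noteq> {}"
                  using n \<delta> by (auto simp: h_def intro!: exI[of _ "real (Suc n) * \<delta>"])
                fix u assume u: "u \<in> {u. 0 \<le> u \<and> t < H u \<omega>}"
                show "real n * \<delta> \<le> u"
                proof (rule ccontr)
                  assume "\<not> real n * \<delta> \<le> u"
                  hence "H u \<omega> \<le> h n \<omega>"
                    unfolding h_def using elim(1) u \<delta> by (auto simp: mono_on_def)
                  with u n show False by simp
                qed
              qed
              hence "l * (real n * \<delta>) \<le> l * L t \<omega>" using elim(2) t l by simp
              moreover have "\<xi> * t \<le> \<xi> * h (Suc n) \<omega>" using n \<xi> by (intro mult_left_mono) auto
              ultimately show "exp (l * (real (Suc n) * \<delta>) - \<xi> * h (Suc n) \<omega>)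
                \<le> exp (l * \<delta> - \<xi> * t) * exp (l * L t \<omega>)"
                by (simp add: algebra_simps flip: exp_add)
            qed
            finally show ?thesis .
          next
            case False
            hence "(\<Sum>n<N. indicator {..t} (h n \<omega>) * indicator {t<..} (h (Suc n) \<omega>)
                * ennreal (exp (l * (real (Suc n) * \<delta>) - \<xi> * h (Suc n) \<omega>))) = 0"
              by (intro sum.neutral) (auto simp: indicator_def)
            also have "0 \<le> ennreal (exp (l * \<delta> - \<xi> * t) * exp (l * L t \<omega>))" by simp
            finally show ?thesis .
          qed
        qed
      qed
      also have "\<dots> = ennreal (exp (l * \<delta> - \<xi> * t) * F)"
        unfolding F_def using F_int by (subst nn_integral_eq_integral) auto
      finally show ?thesis .
    qed
    have A_le: "A N \<le> ennreal (exp (\<zeta> * t - l * \<delta> * real N))" for N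
    proof -
      have "A N \<le> (\<integral>\<^sup>+\<omega>. exp (l * (real N * \<delta>) + \<zeta> * t - \<zeta> * H (real N * \<delta>) \<omega>) \<partial>M)"
        unfolding A_def
      proof (rule nn_integral_mono_AE)
        show "AE \<omega> in M. indicator {..t} (h N \<omega>) * ennreal (exp (l * (real N * \<delta>) - \<xi> * h N \<omega>))
          \<le> ennreal (exp (l * (real N * \<delta>) + \<zeta> * t - \<zeta> * H (real N * \<delta>) \<omega>))"
          using H_mono H_0
        proof eventually_elim
          case (elim \<omega>)
          have "H 0 \<omega> \<le> h N \<omega>" unfolding h_def using elim(1) \<delta> by (auto simp: mono_on_def)
          hence "0 \<le> \<xi> * h N \<omega>" using elim(2) \<xi> by simp
          moreover have "\<zeta> * h N \<omega> \<le> \<zeta> * t" if "h N \<omega> \<le> t"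
            using that \<zeta> by (intro mult_left_mono)
          ultimately show ?case
            by (auto simp: indicator_def h_def intro!: ennreal_leI)
        qed
      qed
      also have "\<dots> = ennreal (exp (l * (real N * \<delta>) + \<zeta> * t - real N * \<delta> * (2 * l)))"
        using \<zeta> \<delta> by (subst LT) auto
      also have "l * (real N * \<delta>) + \<zeta> * t - real N * \<delta> * (2 * l) = \<zeta> * t - l * \<delta> * real N"
        by (simp add: algebra_simps)
      finally show ?thesis .
    qed
    have bound: "1 \<le> exp (l * \<delta> - \<xi> * t) * F + exp (\<zeta> * t - l * \<delta> * real N)" for N
    proof -
      have "ennreal 1 \<le> ennreal (exp (l * \<delta> - \<xi> * t) * F) + ennreal (exp (\<zeta> * t - l * \<delta> * real N))"
        using telescope[of N] add_mono[OF B_le[of N] A_le[of N]] by simp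
      also have "\<dots> = ennreal (exp (l * \<delta> - \<xi> * t) * F + exp (\<zeta> * t - l * \<delta> * real N))"
        using F_nn by simp
      finally show ?thesis using F_nn by (subst (asm) ennreal_le_iff) auto
    qed
    have "0 < l * \<delta>" using l \<delta> by simp
    moreover have "(\<lambda>N. exp (d - c * real N)) \<longlonglongrightarrow> 0" if "0 < c" for c d
      using that by real_asymp
    ultimately have "(\<lambda>N. exp (\<zeta> * t - l * \<delta> * real N)) \<longlonglongrightarrow> 0" by simp
    hence "(\<lambda>N. exp (l * \<delta> - \<xi> * t) * F + exp (\<zeta> * t - l * \<delta> * real N))
      \<longlonglongrightarrow> exp (l * \<delta> - \<xi> * t) * F + 0"
      by (intro tendsto_intros)
    hence "1 \<le> exp (l * \<delta> - \<xi> * t) * F"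
      using bound by (intro LIMSEQ_le_const[of _ _ 1]) auto
    thus ?thesis by (simp add: exp_diff field_simps)
  qed
  have F_pos: "0 < F"
    using order.strict_trans2[OF exp_gt_zero grid[of 1]] by (simp add: zero_less_mult_iff)
  have "\<xi> * t \<le> ln F + e" if "0 < e" for e
  proof -
    have "exp (\<xi> * t) \<le> exp e * F" using grid[of "e / l"] that l by simp
    hence "ln (exp (\<xi> * t)) \<le> ln (exp e * F)" using F_pos by (subst ln_le_cancel_iff) auto
    thus ?thesis using F_pos by (simp add: ln_mult)
  qed
  hence "\<xi> * t \<le> ln F" by (rule field_le_epsilon)
  hence "exp (\<xi> * t) \<le> F" using F_pos by (metis exp_le_cancel_iff exp_ln)
  thus ?thesis by (simp add: F_def \<xi>_def)
qed

lemma inverse_subordinator_mgf_upper_real: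
  assumes \<nu>: "0 < \<nu>" and L: "inverse_stable_subordinator M \<nu> L"
    and t: "0 \<le> t" and e: "0 < e"
  shows "expectation (\<lambda>\<omega>. exp (l * L t \<omega>))
    \<le> exp (1 + ((1 + e) * max 0 l) powr (1 / \<nu>) * t) / (1 - exp (- e))"
proof -
  have L_nn: "\<And>\<omega>. \<omega> \<in> space M \<Longrightarrow> 0 \<le> L t \<omega>"
    using L t by (auto simp: inverse_stable_subordinator_def)
  note int = inverse_subordinator_mgf_integrable[OF \<nu> L t]
  have "expectation (\<lambda>\<omega>. exp (l * L t \<omega>)) \<le> expectation (\<lambda>\<omega>. exp (max 0 l * L t \<omega>))"
    using int L_nn by (intro integral_mono) (auto intro!: mult_right_mono)
  also have "\<dots> \<le> exp (1 + ((1 + e) * max 0 l) powr (1 / \<nu>) * t) / (1 - exp (- e))"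
  proof -
    have nn: "0 \<le> exp (1 + ((1 + e) * max 0 l) powr (1 / \<nu>) * t) / (1 - exp (- e))"
      using e by simp
    show ?thesis
      using inverse_subordinator_mgf_upper[OF \<nu> L t _ e, of "max 0 l"]
      by (simp add: nn_integral_eq_integral[OF int] ennreal_le_iff[OF nn])
  qed
  finally show ?thesis .
qed

text \<open>
  For \<open>l < 0\<close> the bound is Jensen's inequality with \<open>E L\<^sub>t \<le> C t powr \<nu>\<close>. The latter is the upper bound at
  \<open>l = t powr (- \<nu>)\<close> combined with \<open>x \<le> exp x\<close>.
\<close>

lemma inverse_subordinator_mgf_lower_real:
  assumes \<nu>: "0 < \<nu>" and L: "inverse_stable_subordinator M \<nu> L"
  obtains C where "\<And>t l. 0 < t \<Longrightarrow> exp (max 0 l powr (1 / \<nu>) * t - C * (max 0 (- l) * t powr \<nu>))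
    \<le> expectation (\<lambda>\<omega>. exp (l * L t \<omega>))"
proof
  define C where "C = exp (1 + 2 powr (1 / \<nu>)) / (1 - exp (- 1 :: real))"
  fix t l :: real assume t: "0 < t"
  have [measurable]: "L t \<in> borel_measurable M" and L_nn: "\<And>\<omega>. \<omega> \<in> space M \<Longrightarrow> 0 \<le> L t \<omega>"
    using L t by (auto simp: inverse_stable_subordinator_def)
  note int = inverse_subordinator_mgf_integrable[OF \<nu> L less_imp_le[OF t]]
  show "exp (max 0 l powr (1 / \<nu>) * t - C * (max 0 (- l) * t powr \<nu>)) \<le> expectation (\<lambda>\<omega>. exp (l * L t \<omega>))"
  proof (cases "0 \<le> l")
    case True
    thus ?thesis using inverse_subordinator_mgf_lower[OF \<nu> L, of t l] t by (simp add: max_def prob_space)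
  next
    case False
    have L_le: "L t \<omega> \<le> exp (1 * L t \<omega>)" for \<omega>
    proof -
      have "L t \<omega> \<le> exp (L t \<omega>)" using exp_ge_add_one_self[of "L t \<omega>"] by linarith
      thus ?thesis by simp
    qed
    have L_int: "integrable M (L t)"
      by (rule Bochner_Integration.integrable_bound[OF int[of 1]])
         (auto intro!: AE_I2 simp: L_nn order_trans[OF L_le])
    define p where "p = expectation (L t)"
    have "t powr (- \<nu>) * p = expectation (\<lambda>\<omega>. t powr (- \<nu>) * L t \<omega>)"
      by (simp add: p_def)
    also have "\<dots> \<le> expectation (\<lambda>\<omega>. exp (t powr (- \<nu>) * L t \<omega>))"
      using L_int int by (intro integral_mono) (auto intro: order_trans[OF _ exp_ge_add_one_self])
    also have "\<dots> \<le> exp (1 + ((1 + 1) * max 0 (t powr (- \<nu>))) powr (1 / \<nu>) * t) / (1 - exp (- 1))"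
      using t by (intro inverse_subordinator_mgf_upper_real[OF \<nu> L]) auto
    also have "((1 + 1) * max 0 (t powr (- \<nu>))) powr (1 / \<nu>) * t = 2 powr (1 / \<nu>)"
      using t \<nu> by (simp add: max_def powr_mult powr_divide powr_powr powr_minus field_simps)
    finally have "t powr (- \<nu>) * p \<le> C" by (simp add: C_def)
    hence "p \<le> C * t powr \<nu>"
      using t by (simp add: powr_minus field_simps)
    hence "l * (C * t powr \<nu>) \<le> l * p" using False by (intro mult_left_mono_neg) auto
    hence "exp (l * (C * t powr \<nu>)) \<le> exp (l * p)" by simp
    \<comment> \<open>The tangent of the exponential at \<open>l p\<close>, whose linear term has expectation zero.\<close>
    also have "\<dots> = expectation (\<lambda>\<omega>. exp (l * p) * (1 + (l * L t \<omega> - l * p)))"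
      using L_int by (simp add: p_def prob_space)
    also have "\<dots> \<le> expectation (\<lambda>\<omega>. exp (l * p) * exp (l * L t \<omega> - l * p))"
    proof (rule integral_mono)
      show "integrable M (\<lambda>\<omega>. exp (l * p) * exp (l * L t \<omega> - l * p))"
        using int[of l] by (simp flip: exp_add)
    qed (use L_int in \<open>auto intro!: exp_ge_add_one_self\<close>)
    also have "\<dots> = expectation (\<lambda>\<omega>. exp (l * L t \<omega>))" by (simp flip: exp_add)
    finally show ?thesis using False by (simp add: max_def algebra_simps)
  qed
qed

text \<open>
  Squeeze between the two bounds. In the upper one \<open>e = a\<^sub>t\<close> is allowed: the factor \<open>1 + a\<^sub>t\<close> disappears in the limit
  and the constant contributes only \<open>a\<^sub>t ln (1 - exp (- a\<^sub>t))\<close>. In the lower one the term for negative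
  \<open>l\<close> is of order \<open>a\<^sub>t t powr \<nu> (a\<^sub>t t) powr (- \<nu>) = a\<^sub>t powr (1 - \<nu>)\<close>.
\<close>

lemma inverse_subordinator_log_mgf_limit:
  assumes \<nu>: "0 < \<nu>" "\<nu> < 1" and L: "inverse_stable_subordinator M \<nu> L"
    and a_pos: "\<And>t. 0 < t \<Longrightarrow> 0 < a t" and a_lim: "(a \<longlongrightarrow> 0) at_top"
    and l: "((\<lambda>t. l t * (a t * t) powr \<nu>) \<longlongrightarrow> c) at_top"
  shows "((\<lambda>t. a t * ln (expectation (\<lambda>\<omega>. exp (l t * L t \<omega>)))) \<longlongrightarrow> max 0 c powr (1 / \<nu>)) at_top"
proof -
  obtain C where C: "\<And>t l. 0 < t \<Longrightarrow> exp (max 0 l powr (1 / \<nu>) * t - C * (max 0 (- l) * t powr \<nu>))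
    \<le> expectation (\<lambda>\<omega>. exp (l * L t \<omega>))"
    using inverse_subordinator_mgf_lower_real[OF \<nu>(1) L] by blast
  have t_pos: "\<forall>\<^sub>F t in at_top. (0::real) < t" by (rule eventually_gt_at_top)
  have a_nn: "\<forall>\<^sub>F t in at_top. 0 \<le> a t"
    using t_pos by eventually_elim (simp add: a_pos less_imp_le)
  define c' where "c' t = l t * (a t * t) powr \<nu>" for t
  have c': "(c' \<longlongrightarrow> c) at_top" using l by (simp add: c'_def[abs_def])
  have scale: "x powr (1 / \<nu>) * (a t * t) = (x * (a t * t) powr \<nu>) powr (1 / \<nu>)"
    if "0 < t" "0 \<le> x" for t x
    using that a_pos[of t] \<nu> by (simp add: powr_mult powr_powr)
  have max_scale: "max 0 (l t) * (a t * t) powr \<nu> = max 0 (c' t)"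
    "max 0 (- l t) * (a t * t) powr \<nu> = max 0 (- c' t)" for t
    unfolding c'_def by (auto simp: max_def mult_le_0_iff zero_le_mult_iff)
  have "filterlim a (at_right 0) at_top"
  proof -
    have "\<forall>\<^sub>F t in at_top. a t \<in> {0<..} \<and> a t \<noteq> 0"
      using t_pos by eventually_elim (simp add: a_pos less_imp_neq[OF a_pos, symmetric])
    thus ?thesis unfolding filterlim_at using a_lim by simp
  qed
  moreover have "((\<lambda>x::real. x * ln (1 - exp (- x))) \<longlongrightarrow> 0) (at_right 0)" by real_asymp
  ultimately have a_ln: "((\<lambda>t. a t * ln (1 - exp (- a t))) \<longlongrightarrow> 0) at_top"
    by (rule filterlim_compose[rotated])
  show ?thesis
  proof (rule tendsto_sandwich)
    show "\<forall>\<^sub>F t in at_top. max 0 (c' t) powr (1 / \<nu>) - C * (max 0 (- c' t) * a t powr (1 - \<nu>))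
        \<le> a t * ln (expectation (\<lambda>\<omega>. exp (l t * L t \<omega>)))"
      using t_pos
    proof eventually_elim
      case (elim t)
      let ?x = "max 0 (l t) powr (1 / \<nu>) * t - C * (max 0 (- l t) * t powr \<nu>)"
      have "ln (exp ?x) \<le> ln (expectation (\<lambda>\<omega>. exp (l t * L t \<omega>)))"
        using C[OF elim, of "l t"] order.strict_trans2[OF exp_gt_zero C[OF elim, of "l t"]]
        by (subst ln_le_cancel_iff) auto
      hence "a t * ?x \<le> a t * ln (expectation (\<lambda>\<omega>. exp (l t * L t \<omega>)))"
        using a_pos[OF elim] by simp
      moreover have "a t * ?x = max 0 (c' t) powr (1 / \<nu>) - C * (max 0 (- c' t) * a t powr (1 - \<nu>))"
      proof -
        have "a t * ?x = max 0 (l t) powr (1 / \<nu>) * (a t * t) - C * (max 0 (- l t) * (a t * t powr \<nu>))"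
          by (simp add: algebra_simps)
        also have "a t * t powr \<nu> = (a t * t) powr \<nu> * a t powr (1 - \<nu>)"
          using a_pos[OF elim] elim by (simp add: powr_mult powr_diff)
        finally show ?thesis
          using max_scale[of t] scale[OF elim, of "max 0 (l t)"] by (simp add: mult.assoc)
      qed
      ultimately show ?case by simp
    qed
    show "\<forall>\<^sub>F t in at_top. a t * ln (expectation (\<lambda>\<omega>. exp (l t * L t \<omega>)))
        \<le> a t + ((1 + a t) * max 0 (c' t)) powr (1 / \<nu>) - a t * ln (1 - exp (- a t))"
      using t_pos
    proof eventually_elim
      case (elim t)
      have at: "0 < a t" by (rule a_pos[OF elim])
      let ?x = "1 + ((1 + a t) * max 0 (l t)) powr (1 / \<nu>) * t"
      have "ln (expectation (\<lambda>\<omega>. exp (l t * L t \<omega>))) \<le> ln (exp ?x / (1 - exp (- a t)))"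
        using inverse_subordinator_mgf_upper_real[OF \<nu>(1) L less_imp_le[OF elim] at, of "l t"]
          order.strict_trans2[OF exp_gt_zero C[OF elim, of "l t"]] at
        by (subst ln_le_cancel_iff) auto
      also have "\<dots> = ?x - ln (1 - exp (- a t))" using at by (subst ln_div) auto
      finally have "a t * ln (expectation (\<lambda>\<omega>. exp (l t * L t \<omega>))) \<le> a t * (?x - ln (1 - exp (- a t)))"
        using at by simp
      also have "\<dots> = a t + ((1 + a t) * max 0 (l t)) powr (1 / \<nu>) * (a t * t) - a t * ln (1 - exp (- a t))"
        by (simp add: algebra_simps)
      also have "((1 + a t) * max 0 (l t)) powr (1 / \<nu>) * (a t * t) = ((1 + a t) * max 0 (c' t)) powr (1 / \<nu>)"
        using scale[OF elim, of "(1 + a t) * max 0 (l t)"] max_scale[of t] at by (simp add: mult.assoc)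
      finally show ?case .
    qed
    have "((\<lambda>t. max 0 (c' t) powr (1 / \<nu>)) \<longlongrightarrow> max 0 c powr (1 / \<nu>)) at_top"
      using \<nu> by (intro tendsto_powr' tendsto_intros c') auto
    moreover have "((\<lambda>t. C * (max 0 (- c' t) * a t powr (1 - \<nu>))) \<longlongrightarrow> C * (max 0 (- c) * 0 powr (1 - \<nu>))) at_top"
      using \<nu> a_nn by (intro tendsto_powr' tendsto_intros c' a_lim) auto
    ultimately show "((\<lambda>t. max 0 (c' t) powr (1 / \<nu>) - C * (max 0 (- c' t) * a t powr (1 - \<nu>)))
        \<longlongrightarrow> max 0 c powr (1 / \<nu>)) at_top"
      using tendsto_diff by fastforce
    have "((\<lambda>t. ((1 + a t) * max 0 (c' t)) powr (1 / \<nu>)) \<longlongrightarrow> ((1 + 0) * max 0 c) powr (1 / \<nu>)) at_top"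
      using \<nu> a_nn by (intro tendsto_powr' tendsto_intros c' a_lim) (auto elim!: eventually_mono)
    hence "((\<lambda>t. a t + ((1 + a t) * max 0 (c' t)) powr (1 / \<nu>) - a t * ln (1 - exp (- a t)))
        \<longlongrightarrow> 0 + ((1 + 0) * max 0 c) powr (1 / \<nu>) - 0) at_top"
      by (intro tendsto_diff tendsto_add a_lim a_ln)
    thus "((\<lambda>t. a t + ((1 + a t) * max 0 (c' t)) powr (1 / \<nu>) - a t * ln (1 - exp (- a t)))
        \<longlongrightarrow> max 0 c powr (1 / \<nu>)) at_top" by simp
  qed
qed

end

section \<open>A Levy process at an independent random time\<close>

text \<open>
  Strictly above \<open>x\<close>, so that right continuity of the paths applies along \<open>n\<close>.
\<close>

definition dyadic_above :: "nat \<Rightarrow> real \<Rightarrow> real" where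
  "dyadic_above n x = real (Suc (nat \<lfloor>2 ^ n * x\<rfloor>)) / 2 ^ n"

lemma dyadic_above_bounds:
  assumes "0 \<le> x"
  shows "x < dyadic_above n x" "dyadic_above n x \<le> x + 1 / 2 ^ n" "dyadic_above n x \<le> x + 1"
proof -
  have "0 \<le> \<lfloor>2 ^ n * x\<rfloor>" using assms by simp
  hence eq: "real (Suc (nat \<lfloor>2 ^ n * x\<rfloor>)) = of_int \<lfloor>2 ^ n * x\<rfloor> + 1" by simp
  show "x < dyadic_above n x" "dyadic_above n x \<le> x + 1 / 2 ^ n"
    unfolding dyadic_above_def eq by (simp_all add: field_simps) linarith+
  moreover have "1 / 2 ^ n \<le> (1::real)" by (simp add: field_simps)
  ultimately show "dyadic_above n x \<le> x + 1" by linarith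
qed

lemma dyadic_above_tendsto:
  assumes "0 \<le> x"
  shows "filterlim (\<lambda>n. dyadic_above n x) (at_right x) sequentially"
proof -
  have "(\<lambda>n. x + 1 / 2 ^ n) \<longlonglongrightarrow> x + 0"
    by (intro tendsto_intros LIMSEQ_divide_realpow_zero) simp
  hence upper: "(\<lambda>n. x + 1 / 2 ^ n) \<longlonglongrightarrow> x" by simp
  have "(\<lambda>n. dyadic_above n x) \<longlonglongrightarrow> x"
    by (rule tendsto_sandwich[OF _ _ tendsto_const upper])
       (simp_all add: dyadic_above_bounds[OF assms] less_imp_le)
  moreover have "dyadic_above n x \<in> {x<..} \<and> dyadic_above n x \<noteq> x" for n
    using dyadic_above_bounds(1)[OF assms, of n] by auto
  ultimately show ?thesis by (simp add: filterlim_at)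
qed

lemma cadlag_dyadic_above:
  assumes "cadlag f" "0 \<le> x"
  shows "(\<lambda>n. f (dyadic_above n x)) \<longlonglongrightarrow> f x"
proof -
  have "(f \<longlongrightarrow> f x) (at_right x)" using assms by (simp add: cadlag_def)
  thus ?thesis by (rule filterlim_compose[OF _ dyadic_above_tendsto[OF assms(2)]])
qed

context prob_space
begin

text \<open>
  A bounded second moment implies uniform integrability: the part of \<open>X\<close> above a level \<open>R\<close> contributes at most
  \<open>K / R\<close>, because \<open>x \<le> min x R + x\<^sup>2 / R\<close>. The truncated variables converge by dominated convergence.
\<close>

lemma expectation_limit_of_bounded_second_moment:
  fixes X :: "nat \<Rightarrow> 'a \<Rightarrow> real"
  assumes X: "\<And>n. integrable M (X n)" "\<And>n \<omega>. 0 \<le> X n \<omega>"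
    and Y [measurable]: "Y \<in> borel_measurable M"
    and conv: "\<And>\<omega>. \<omega> \<in> space M \<Longrightarrow> (\<lambda>n. X n \<omega>) \<longlonglongrightarrow> Y \<omega>"
    and lim: "(\<lambda>n. expectation (X n)) \<longlonglongrightarrow> l"
    and sq: "\<And>n. integrable M (\<lambda>\<omega>. X n \<omega> ^ 2)" "\<And>n. expectation (\<lambda>\<omega>. X n \<omega> ^ 2) \<le> K"
  shows "integrable M Y" and "expectation Y = l"
proof -
  have [measurable]: "X n \<in> borel_measurable M" for n
    using X(1) by (rule borel_measurable_integrable)
  have Y_nn: "0 \<le> Y \<omega>" if "\<omega> \<in> space M" for \<omega>
    using conv[OF that] X(2) by (intro LIMSEQ_le_const[of _ _ 0]) auto
  have "(\<integral>\<^sup>+\<omega>. Y \<omega> \<partial>M) = (\<integral>\<^sup>+\<omega>. liminf (\<lambda>n. ennreal (X n \<omega>)) \<partial>M)"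
  proof (rule nn_integral_cong)
    fix \<omega> assume "\<omega> \<in> space M"
    hence "(\<lambda>n. ennreal (X n \<omega>)) \<longlonglongrightarrow> ennreal (Y \<omega>)"
      by (intro tendsto_ennrealI conv)
    thus "ennreal (Y \<omega>) = liminf (\<lambda>n. ennreal (X n \<omega>))"
      by (simp add: lim_imp_Liminf)
  qed
  also have "\<dots> \<le> liminf (\<lambda>n. \<integral>\<^sup>+\<omega>. X n \<omega> \<partial>M)"
    by (rule nn_integral_liminf) simp
  also have "(\<lambda>n. \<integral>\<^sup>+\<omega>. X n \<omega> \<partial>M) = (\<lambda>n. ennreal (expectation (X n)))"
    using X by (intro ext nn_integral_eq_integral) auto
  also have "liminf (\<lambda>n. ennreal (expectation (X n))) = ennreal l"
    using lim by (intro lim_imp_Liminf tendsto_ennrealI) auto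
  finally have fatou: "(\<integral>\<^sup>+\<omega>. Y \<omega> \<partial>M) \<le> ennreal l" .
  show Y_int: "integrable M Y"
    using fatou Y_nn by (intro integrableI_nonneg) (auto simp: less_top[symmetric] top_unique)
  have "0 \<le> l" using lim X by (intro LIMSEQ_le_const[of _ _ 0]) auto
  hence "expectation Y \<le> l"
    using fatou Y_int Y_nn by (subst (asm) nn_integral_eq_integral) (auto simp: ennreal_le_iff)
  moreover have "l \<le> expectation Y"
  proof (rule field_le_epsilon)
    fix e :: real assume e: "0 < e"
    have K: "0 \<le> K" using sq(2)[of 0] by (rule order_trans[rotated]) simp
    define R where "R = (K + 1) / e"
    have R: "0 < R" using e K by (simp add: R_def)
    have trunc_int: "integrable M (\<lambda>\<omega>. min (X n \<omega>) R)" for n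
      using X(1)[of n] by (rule Bochner_Integration.integrable_bound) (use X(2)[of n] R in auto)
    have "(\<lambda>n. expectation (\<lambda>\<omega>. min (X n \<omega>) R)) \<longlonglongrightarrow> expectation (\<lambda>\<omega>. min (Y \<omega>) R)"
    proof (rule integral_dominated_convergence[where w="\<lambda>_. R"])
      show "AE \<omega> in M. (\<lambda>n. min (X n \<omega>) R) \<longlonglongrightarrow> min (Y \<omega>) R"
        by (intro AE_I2 tendsto_intros conv)
      show "AE \<omega> in M. norm (min (X n \<omega>) R) \<le> R" for n
        using X(2)[of n] R by auto
    qed auto
    hence "(\<lambda>n. expectation (\<lambda>\<omega>. min (X n \<omega>) R) + K / R) \<longlonglongrightarrow> expectation (\<lambda>\<omega>. min (Y \<omega>) R) + K / R"
      by (intro tendsto_intros)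
    moreover have "expectation (X n) \<le> expectation (\<lambda>\<omega>. min (X n \<omega>) R) + K / R" for n
    proof -
      have "expectation (X n) \<le> expectation (\<lambda>\<omega>. min (X n \<omega>) R + X n \<omega> ^ 2 / R)"
      proof (rule integral_mono)
        fix \<omega>
        show "X n \<omega> \<le> min (X n \<omega>) R + X n \<omega> ^ 2 / R"
        proof (cases "X n \<omega> \<le> R")
          case False
          hence "X n \<omega> * R \<le> X n \<omega> ^ 2"
            using R by (simp add: power2_eq_square)
          hence "X n \<omega> \<le> X n \<omega> ^ 2 / R" using R by (simp add: field_simps)
          thus ?thesis using R X(2)[of n \<omega>] by (simp add: min_def)
        qed (use R in simp)
      qed (use X(1) trunc_int sq(1) in auto)
      also have "\<dots> = expectation (\<lambda>\<omega>. min (X n \<omega>) R) + expectation (\<lambda>\<omega>. X n \<omega> ^ 2) / R"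
        using trunc_int sq(1) by simp
      also have "\<dots> \<le> expectation (\<lambda>\<omega>. min (X n \<omega>) R) + K / R"
        using sq(2)[of n] R by (simp add: divide_right_mono)
      finally show ?thesis .
    qed
    ultimately have "l \<le> expectation (\<lambda>\<omega>. min (Y \<omega>) R) + K / R"
      using lim by (intro LIMSEQ_le) auto
    also have "expectation (\<lambda>\<omega>. min (Y \<omega>) R) \<le> expectation Y"
    proof (rule integral_mono)
      show "integrable M (\<lambda>\<omega>. min (Y \<omega>) R)"
        using Y_int by (rule Bochner_Integration.integrable_bound) (use Y_nn R in auto)
    qed (use Y_int in auto)
    also have "K / R \<le> e" using e K by (simp add: R_def field_simps)
    finally show "l \<le> expectation Y + e" by simp
  qed
  ultimately show "expectation Y = l" by simp
qed

lemma levy_at_dyadic_time_measurable: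
  assumes X: "levy_process M X" and [measurable]: "T \<in> borel_measurable M"
  shows "(\<lambda>\<omega>. X (dyadic_above n (T \<omega>)) \<omega>) \<in> borel_measurable M"
proof -
  have "X (real (Suc k) / 2 ^ n) \<in> borel_measurable M" for k
    using X by (simp add: levy_process_def)
  thus ?thesis unfolding dyadic_above_def
    by (rule measurable_compose_countable[where f="\<lambda>k. X (real (Suc k) / 2 ^ n)"]) measurable
qed

lemma levy_at_random_time_measurable:
  assumes X: "levy_process M X" and T [measurable]: "T \<in> borel_measurable M"
    and T_nn: "\<And>\<omega>. \<omega> \<in> space M \<Longrightarrow> 0 \<le> T \<omega>"
  shows "(\<lambda>\<omega>. X (T \<omega>) \<omega>) \<in> borel_measurable M"
proof (rule borel_measurable_LIMSEQ_real)
  show "(\<lambda>n. X (dyadic_above n (T \<omega>)) \<omega>) \<longlonglongrightarrow> X (T \<omega>) \<omega>" if "\<omega> \<in> space M" for \<omega>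
    using X that T_nn by (intro cadlag_dyadic_above[where f="\<lambda>t. X t \<omega>"]) (auto simp: levy_process_def)
qed (rule levy_at_dyadic_time_measurable[OF X T])

text \<open>
  The random time takes countably many values; on each of them independence separates \<open>X\<close> at a fixed time from
  the event.
\<close>

lemma levy_mgf_at_dyadic_time:
  assumes X: "levy_process M X" and int: "integrable M (\<lambda>\<omega>. exp (\<theta> * X 1 \<omega>))"
    and T [measurable]: "T \<in> borel_measurable M"
    and indep: "\<And>u. 0 \<le> u \<Longrightarrow> indep_var borel (X u) borel T"
  shows "(\<integral>\<^sup>+\<omega>. exp (\<theta> * X (dyadic_above n (T \<omega>)) \<omega>) \<partial>M)
    = (\<integral>\<^sup>+\<omega>. exp (cgf M (X 1) \<theta> * dyadic_above n (T \<omega>)) \<partial>M)"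
proof -
  define A where "A k = {x::real. nat \<lfloor>2 ^ n * x\<rfloor> = k}" for k
  have [measurable]: "A k \<in> sets borel" for k unfolding A_def by measurable
  have [measurable]: "X (real k / 2 ^ n) \<in> borel_measurable M" for k
    using X by (simp add: levy_process_def)
  have split: "(\<integral>\<^sup>+\<omega>. f (Suc (nat \<lfloor>2 ^ n * T \<omega>\<rfloor>)) \<omega> \<partial>M) = (\<Sum>k. \<integral>\<^sup>+\<omega>. f (Suc k) \<omega> * indicator (A k) (T \<omega>) \<partial>M)"
    if [measurable]: "\<And>k. f k \<in> borel_measurable M" for f :: "nat \<Rightarrow> 'a \<Rightarrow> ennreal"
  proof -
    have "f (Suc (nat \<lfloor>2 ^ n * T \<omega>\<rfloor>)) \<omega> = (\<Sum>k. f (Suc k) \<omega> * indicator (A k) (T \<omega>))" for \<omega>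
      by (subst suminf_finite[of "{nat \<lfloor>2 ^ n * T \<omega>\<rfloor>}"]) (auto simp: A_def)
    thus ?thesis by (simp add: nn_integral_suminf)
  qed
  have "(\<integral>\<^sup>+\<omega>. exp (\<theta> * X (dyadic_above n (T \<omega>)) \<omega>) \<partial>M)
    = (\<Sum>k. \<integral>\<^sup>+\<omega>. ennreal (exp (\<theta> * X (real (Suc k) / 2 ^ n) \<omega>)) * indicator (A k) (T \<omega>) \<partial>M)"
    unfolding dyadic_above_def
    by (rule split[of "\<lambda>k \<omega>. ennreal (exp (\<theta> * X (real k / 2 ^ n) \<omega>))"]) simp
  also have "(\<lambda>k. \<integral>\<^sup>+\<omega>. ennreal (exp (\<theta> * X (real (Suc k) / 2 ^ n) \<omega>)) * indicator (A k) (T \<omega>) \<partial>M)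
    = (\<lambda>k. \<integral>\<^sup>+\<omega>. ennreal (exp (cgf M (X 1) \<theta> * (real (Suc k) / 2 ^ n))) * indicator (A k) (T \<omega>) \<partial>M)"
  proof
    fix k
    have "(\<integral>\<^sup>+\<omega>. ennreal (exp (\<theta> * X (real (Suc k) / 2 ^ n) \<omega>)) * indicator (A k) (T \<omega>) \<partial>M)
      = (\<integral>\<^sup>+\<omega>. ennreal (exp (\<theta> * X (real (Suc k) / 2 ^ n) \<omega>)) \<partial>M) * (\<integral>\<^sup>+\<omega>. indicator (A k) (T \<omega>) \<partial>M)"
      by (intro indep_var_nn_integral_mult[OF indep, where f="\<lambda>x. ennreal (exp (\<theta> * x))"]) auto
    also have "\<dots> = (\<integral>\<^sup>+\<omega>. ennreal (exp (cgf M (X 1) \<theta> * (real (Suc k) / 2 ^ n))) * indicator (A k) (T \<omega>) \<partial>M)"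
      by (subst levy_exp_moment_grid[OF X int], subst nn_integral_cmult) auto
    finally show "(\<integral>\<^sup>+\<omega>. ennreal (exp (\<theta> * X (real (Suc k) / 2 ^ n) \<omega>)) * indicator (A k) (T \<omega>) \<partial>M)
      = (\<integral>\<^sup>+\<omega>. ennreal (exp (cgf M (X 1) \<theta> * (real (Suc k) / 2 ^ n))) * indicator (A k) (T \<omega>) \<partial>M)" .
  qed
  also have "(\<Sum>k. \<integral>\<^sup>+\<omega>. ennreal (exp (cgf M (X 1) \<theta> * (real (Suc k) / 2 ^ n))) * indicator (A k) (T \<omega>) \<partial>M)
    = (\<integral>\<^sup>+\<omega>. exp (cgf M (X 1) \<theta> * dyadic_above n (T \<omega>)) \<partial>M)"
    unfolding dyadic_above_def
    by (rule split[of "\<lambda>k \<omega>. ennreal (exp (cgf M (X 1) \<theta> * (real k / 2 ^ n)))", symmetric]) simp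
  finally show ?thesis .
qed

text \<open>
  Along dyadic approximations of \<open>T\<close> from above the paths converge by right continuity. The second moments at
  these times are exponential moments at \<open>2 \<theta>\<close>, bounded because \<open>T\<close> has all exponential moments, so
  that the expectations converge as well.
\<close>

lemma levy_mgf_at_independent_time:
  assumes X: "levy_process M X" and int: "\<And>s. s \<in> {\<theta>, 2 * \<theta>} \<Longrightarrow> integrable M (\<lambda>\<omega>. exp (s * X 1 \<omega>))"
    and T [measurable]: "T \<in> borel_measurable M"
    and T_nn: "\<And>\<omega>. \<omega> \<in> space M \<Longrightarrow> 0 \<le> T \<omega>"
    and T_exp: "\<And>l. integrable M (\<lambda>\<omega>. exp (l * T \<omega>))"
    and indep: "\<And>u. 0 \<le> u \<Longrightarrow> indep_var borel (X u) borel T"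
  shows "integrable M (\<lambda>\<omega>. exp (\<theta> * X (T \<omega>) \<omega>))"
    and "expectation (\<lambda>\<omega>. exp (\<theta> * X (T \<omega>) \<omega>)) = expectation (\<lambda>\<omega>. exp (cgf M (X 1) \<theta> * T \<omega>))"
proof -
  note [measurable] = levy_at_dyadic_time_measurable[OF X T] levy_at_random_time_measurable[OF X T T_nn]
  have [measurable]: "(\<lambda>\<omega>. dyadic_above n (T \<omega>)) \<in> borel_measurable M" for n
    unfolding dyadic_above_def by measurable
  have dom_int: "integrable M (\<lambda>\<omega>. exp (\<bar>l\<bar> * (T \<omega> + 1)))" for l
    using T_exp[of "\<bar>l\<bar>"] by (simp add: algebra_simps exp_add)
  have dom: "exp (l * dyadic_above n (T \<omega>)) \<le> exp (\<bar>l\<bar> * (T \<omega> + 1))" if "\<omega> \<in> space M" for l n \<omega>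
  proof -
    have "l * dyadic_above n (T \<omega>) \<le> \<bar>l\<bar> * dyadic_above n (T \<omega>)"
      using dyadic_above_bounds(1)[OF T_nn[OF that], of n] T_nn[OF that] by (intro mult_right_mono) auto
    also have "\<dots> \<le> \<bar>l\<bar> * (T \<omega> + 1)"
      using dyadic_above_bounds(3)[OF T_nn[OF that], of n] by (intro mult_left_mono) auto
    finally show ?thesis by simp
  qed
  have grid_int: "integrable M (\<lambda>\<omega>. exp (l * dyadic_above n (T \<omega>)))" for l n
    by (rule Bochner_Integration.integrable_bound[OF dom_int[of l]]) (use dom in auto)
  have grid: "integrable M (\<lambda>\<omega>. exp (s * X (dyadic_above n (T \<omega>)) \<omega>))"
    "expectation (\<lambda>\<omega>. exp (s * X (dyadic_above n (T \<omega>)) \<omega>))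
      = expectation (\<lambda>\<omega>. exp (cgf M (X 1) s * dyadic_above n (T \<omega>)))"
    if "s \<in> {\<theta>, 2 * \<theta>}" for s n
  proof -
    have "(\<integral>\<^sup>+\<omega>. exp (s * X (dyadic_above n (T \<omega>)) \<omega>) \<partial>M)
      = ennreal (expectation (\<lambda>\<omega>. exp (cgf M (X 1) s * dyadic_above n (T \<omega>))))"
      using grid_int[of "cgf M (X 1) s" n]
      by (subst levy_mgf_at_dyadic_time[OF X int[OF that] T indep]) (auto intro!: nn_integral_eq_integral)
    moreover have "0 \<le> expectation (\<lambda>\<omega>. exp (cgf M (X 1) s * dyadic_above n (T \<omega>)))" by simp
    ultimately have "has_bochner_integral M (\<lambda>\<omega>. exp (s * X (dyadic_above n (T \<omega>)) \<omega>))
        (expectation (\<lambda>\<omega>. exp (cgf M (X 1) s * dyadic_above n (T \<omega>))))"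
      by (intro has_bochner_integral_nn_integral) simp_all
    thus "integrable M (\<lambda>\<omega>. exp (s * X (dyadic_above n (T \<omega>)) \<omega>))"
      "expectation (\<lambda>\<omega>. exp (s * X (dyadic_above n (T \<omega>)) \<omega>))
      = expectation (\<lambda>\<omega>. exp (cgf M (X 1) s * dyadic_above n (T \<omega>)))"
      by (simp_all add: has_bochner_integral_iff)
  qed
  have sq: "exp x ^ 2 = exp (2 * x)" for x :: real by (simp flip: exp_of_nat_mult)
  define K where "K = expectation (\<lambda>\<omega>. exp (\<bar>cgf M (X 1) (2 * \<theta>)\<bar> * (T \<omega> + 1)))"
  have path: "(\<lambda>n. exp (\<theta> * X (dyadic_above n (T \<omega>)) \<omega>)) \<longlonglongrightarrow> exp (\<theta> * X (T \<omega>) \<omega>)"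
    if "\<omega> \<in> space M" for \<omega>
    using X that T_nn by (intro tendsto_intros cadlag_dyadic_above[where f="\<lambda>t. X t \<omega>"])
      (auto simp: levy_process_def)
  have lim: "(\<lambda>n. expectation (\<lambda>\<omega>. exp (\<theta> * X (dyadic_above n (T \<omega>)) \<omega>)))
    \<longlonglongrightarrow> expectation (\<lambda>\<omega>. exp (cgf M (X 1) \<theta> * T \<omega>))"
  proof (subst grid(2))
    show "(\<lambda>n. expectation (\<lambda>\<omega>. exp (cgf M (X 1) \<theta> * dyadic_above n (T \<omega>))))
      \<longlonglongrightarrow> expectation (\<lambda>\<omega>. exp (cgf M (X 1) \<theta> * T \<omega>))"
    proof (rule integral_dominated_convergence[where w="\<lambda>\<omega>. exp (\<bar>cgf M (X 1) \<theta>\<bar> * (T \<omega> + 1))"])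
      show "AE \<omega> in M. (\<lambda>n. exp (cgf M (X 1) \<theta> * dyadic_above n (T \<omega>))) \<longlonglongrightarrow> exp (cgf M (X 1) \<theta> * T \<omega>)"
        using dyadic_above_tendsto T_nn by (intro AE_I2 tendsto_intros) (auto simp: filterlim_at)
      show "AE \<omega> in M. norm (exp (cgf M (X 1) \<theta> * dyadic_above n (T \<omega>)))
        \<le> exp (\<bar>cgf M (X 1) \<theta>\<bar> * (T \<omega> + 1))" for n
        using dom by auto
    qed (use dom_int in auto)
  qed simp
  have sq_int: "integrable M (\<lambda>\<omega>. exp (\<theta> * X (dyadic_above n (T \<omega>)) \<omega>) ^ 2)" for n
    using grid(1)[of "2 * \<theta>" n] by (simp add: sq mult.assoc)
  have sq_le: "expectation (\<lambda>\<omega>. exp (\<theta> * X (dyadic_above n (T \<omega>)) \<omega>) ^ 2) \<le> K" for n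
  proof -
    have "expectation (\<lambda>\<omega>. exp (\<theta> * X (dyadic_above n (T \<omega>)) \<omega>) ^ 2)
      = expectation (\<lambda>\<omega>. exp (cgf M (X 1) (2 * \<theta>) * dyadic_above n (T \<omega>)))"
      using grid(2)[of "2 * \<theta>" n] by (simp add: sq mult.assoc)
    also have "\<dots> \<le> K"
      unfolding K_def using grid_int dom_int dom by (intro integral_mono) auto
    finally show ?thesis .
  qed
  show "integrable M (\<lambda>\<omega>. exp (\<theta> * X (T \<omega>) \<omega>))"
    by (rule expectation_limit_of_bounded_second_moment(1)[OF _ _ _ path lim sq_int sq_le])
       (auto intro: grid(1))
  show "expectation (\<lambda>\<omega>. exp (\<theta> * X (T \<omega>) \<omega>)) = expectation (\<lambda>\<omega>. exp (cgf M (X 1) \<theta> * T \<omega>))"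
    by (rule expectation_limit_of_bounded_second_moment(2)[OF _ _ _ path lim sq_int sq_le])
       (auto intro: grid(1))
qed

lemma independent_processes_indep_var:
  assumes "independent_processes M X Y" "0 \<le> u" "0 \<le> t"
  shows "indep_var borel (X u) borel (Y t)"
proof -
  have "indep_var borel ((\<lambda>x. x u) \<circ> (\<lambda>\<omega>. \<lambda>t\<in>{0..}. X t \<omega>)) borel ((\<lambda>y. y t) \<circ> (\<lambda>\<omega>. \<lambda>t\<in>{0..}. Y t \<omega>))"
    using assms unfolding independent_processes_def
    by (intro indep_var_compose measurable_component_singleton) auto
  thus ?thesis using assms by (simp add: comp_def)
qed

end

section \<open>The rate function as a Legendre transform\<close>

lemma DERIV_positive_part_powr:
  assumes p: "1 < p"
  shows "DERIV (\<lambda>u::real. max 0 u powr p) u :> p * max 0 u powr (p - 1)"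
proof -
  consider "0 < u" | "u < 0" | "u = 0" by linarith
  thus ?thesis
  proof cases
    case 1
    have ev: "\<forall>\<^sub>F v in nhds u. max 0 v powr p = v powr p"
      using eventually_nhds_in_open[of "{0<..}" u] 1 by (auto elim!: eventually_mono simp: max_def)
    have "DERIV (\<lambda>v. v powr p) u :> p * u powr (p - 1)"
      using 1 by (rule has_real_derivative_powr)
    thus ?thesis using DERIV_cong_ev[OF refl ev refl] 1 by (simp add: max_def)
  next
    case 2
    have ev: "\<forall>\<^sub>F v in nhds u. max 0 v powr p = 0"
      using eventually_nhds_in_open[of "{..<0}" u] 2 by (auto elim!: eventually_mono simp: max_def)
    thus ?thesis using DERIV_cong_ev[OF refl ev refl] 2 by (simp add: max_def)
  next
    case 3
    have "((\<lambda>h::real. max 0 h powr p / h) \<longlongrightarrow> 0) (at 0)"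
    proof (rule Lim_null_comparison)
      show "\<forall>\<^sub>F h in at 0. norm (max 0 h powr p / h) \<le> \<bar>h\<bar> powr (p - 1)"
      proof -
        have "norm (max 0 h powr p / h) \<le> \<bar>h\<bar> powr (p - 1)" if "h \<noteq> 0" for h :: real
          using that by (cases "0 < h") (auto simp: max_def powr_diff intro: divide_nonneg_nonpos)
        thus ?thesis by (auto simp: eventually_at_filter)
      qed
      have "((\<lambda>h::real. \<bar>h\<bar> powr (p - 1)) \<longlongrightarrow> \<bar>0\<bar> powr (p - 1)) (at 0)"
        using p by (intro tendsto_powr' tendsto_intros) auto
      thus "((\<lambda>h::real. \<bar>h\<bar> powr (p - 1)) \<longlongrightarrow> 0) (at 0)" by simp
    qed
    thus ?thesis using 3 p by (simp add: DERIV_def)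
  qed
qed

text \<open>
  Legendre transform of \<open>u powr (1 / \<mu>)\<close> on the positive half line: \<open>u\<close> is the point where the derivative is \<open>y\<close>.
\<close>

lemma legendre_power:
  fixes \<mu> y :: real
  assumes \<mu>: "0 < \<mu>" "\<mu> < 1" and y: "0 \<le> y"
  defines "u \<equiv> (\<mu> * y) powr (\<mu> / (1 - \<mu>))"
  shows "1 / \<mu> * u powr (1 / \<mu> - 1) = y"
    and "u * y - u powr (1 / \<mu>) = (\<mu> powr (\<mu> / (1 - \<mu>)) - \<mu> powr (1 / (1 - \<mu>))) * y powr (1 / (1 - \<mu>))"
proof -
  have "\<mu> / (1 - \<mu>) * (1 / \<mu> - 1) = 1" using \<mu> by (simp add: field_simps)
  thus "1 / \<mu> * u powr (1 / \<mu> - 1) = y"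
    unfolding u_def powr_powr using \<mu> y by simp
  have e: "\<mu> / (1 - \<mu>) * (1 / \<mu>) = 1 / (1 - \<mu>)" "\<mu> / (1 - \<mu>) + 1 = 1 / (1 - \<mu>)"
    using \<mu> by (simp_all add: field_simps)
  have "u * y = \<mu> powr (\<mu> / (1 - \<mu>)) * (y powr (\<mu> / (1 - \<mu>)) * y powr 1)"
    unfolding u_def using \<mu> y by (simp add: powr_mult)
  also have "y powr (\<mu> / (1 - \<mu>)) * y powr 1 = y powr (1 / (1 - \<mu>))"
    by (simp only: e(2) flip: powr_add)
  finally show "u * y - u powr (1 / \<mu>)
      = (\<mu> powr (\<mu> / (1 - \<mu>)) - \<mu> powr (1 / (1 - \<mu>))) * y powr (1 / (1 - \<mu>))"
    unfolding u_def powr_powr e(1) using \<mu> y by (simp add: powr_mult left_diff_distrib)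
qed

text \<open>
  The limiting cumulant generating function: the leading term of the cumulant generating function of \<open>S 1\<close> at the
  origin, inserted in the limit \<open>max 0 c powr (1 / \<nu>)\<close> for the inverse stable subordinator.
\<close>

definition MD_cgf :: "real \<Rightarrow> real \<Rightarrow> real \<Rightarrow> real \<Rightarrow> real" where
  "MD_cgf \<nu> q m \<theta> = max 0 (if m = 0 then q * \<theta>\<^sup>2 / 2 else m * \<theta>) powr (1 / \<nu>)"

text \<open>
  Both cases reduce to the transform of a power by rescaling. If \<open>m \<noteq> 0\<close>, then \<open>\<mu> = \<nu>\<close> and \<open>y = x / m\<close>. If \<open>m = 0\<close>,
  then the limit is \<open>\<bar>b \<theta>\<bar> powr (2 / \<nu>)\<close> with \<open>b\<^sup>2 = q / 2\<close>, so that \<open>\<mu> = \<nu> / 2\<close>, \<open>y = \<bar>x\<bar> / b\<close>, and \<open>\<theta>\<close> takes the sign of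
  \<open>x\<close>. Writing this as the sum of its positive and negative parts makes it differentiable at the
  origin by the lemma on positive parts.
\<close>

lemma I_MD_exposed:
  assumes \<nu>: "0 < \<nu>" "\<nu> < 1" and q: "m = 0 \<Longrightarrow> 0 < q" and fin: "I_MD \<nu> q m x \<noteq> \<infinity>"
  shows "\<exists>\<theta>. 0 \<le> \<theta> * x \<and> DERIV (MD_cgf \<nu> q m) \<theta> :> x \<and> I_MD \<nu> q m x = ereal (\<theta> * x - MD_cgf \<nu> q m \<theta>)"
proof (cases "m = 0")
  case False
  define y where "y = x / m"
  have y: "0 \<le> y" using fin False by (auto simp: I_MD_def y_def split: if_splits)
  define u where "u = (\<nu> * y) powr (\<nu> / (1 - \<nu>))"
  note leg = legendre_power[OF \<nu> y, folded u_def]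
  have u: "0 \<le> u" by (simp add: u_def)
  have x: "x = m * y" using False by (simp add: y_def)
  have cgf: "MD_cgf \<nu> q m = (\<lambda>\<theta>. max 0 (m * \<theta>) powr (1 / \<nu>))"
    using False by (simp add: MD_cgf_def fun_eq_iff)
  have "DERIV (\<lambda>\<theta>. max 0 (m * \<theta>) powr (1 / \<nu>)) (u / m) :> 1 / \<nu> * max 0 (m * (u / m)) powr (1 / \<nu> - 1) * m"
    using \<nu> by (intro DERIV_chain2[OF DERIV_positive_part_powr] derivative_eq_intros) auto
  also have "1 / \<nu> * max 0 (m * (u / m)) powr (1 / \<nu> - 1) * m = x"
    using leg(1) u False x by (simp add: max_def)
  finally have "DERIV (MD_cgf \<nu> q m) (u / m) :> x" by (simp add: cgf)
  moreover have "u / m * x = u * y" by (simp add: y_def)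
  moreover have "I_MD \<nu> q m x = ereal (u * y - u powr (1 / \<nu>))"
    using False y unfolding leg(2) by (simp add: I_MD_def y_def)
  moreover have "MD_cgf \<nu> q m (u / m) = u powr (1 / \<nu>)"
    using False u by (simp add: cgf max_def)
  ultimately show ?thesis using u y by (intro exI[of _ "u / m"]) auto
next
  case True
  have q: "0 < q" using q True by simp
  define \<mu> where "\<mu> = \<nu> / 2"
  have \<mu>: "0 < \<mu>" "\<mu> < 1" using \<nu> by (auto simp: \<mu>_def)
  define b where "b = sqrt (q / 2)"
  have b: "0 < b" "b\<^sup>2 = q / 2" using q by (auto simp: b_def)
  define y where "y = \<bar>x\<bar> / b"
  have y: "0 \<le> y" using b by (simp add: y_def)
  define u where "u = (\<mu> * y) powr (\<mu> / (1 - \<mu>))"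
  note leg = legendre_power[OF \<mu> y, folded u_def]
  have u: "0 \<le> u" by (simp add: u_def)
  have cgf: "MD_cgf \<nu> q m \<theta> = max 0 (b * \<theta>) powr (1 / \<mu>) + max 0 (- b * \<theta>) powr (1 / \<mu>)" for \<theta>
  proof -
    have "MD_cgf \<nu> q m \<theta> = (q * \<theta>\<^sup>2 / 2) powr (1 / \<nu>)"
      using True q by (simp add: MD_cgf_def max_def)
    also have "q * \<theta>\<^sup>2 / 2 = \<bar>b * \<theta>\<bar> powr 2"
      using b by (simp add: power_mult_distrib)
    also have "(\<bar>b * \<theta>\<bar> powr 2) powr (1 / \<nu>) = \<bar>b * \<theta>\<bar> powr (1 / \<mu>)"
      by (simp only: powr_powr) (simp add: \<mu>_def)
    also have "\<dots> = max 0 (b * \<theta>) powr (1 / \<mu>) + max 0 (- b * \<theta>) powr (1 / \<mu>)"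
      by (cases "0 \<le> b * \<theta>") (auto simp: max_def)
    finally show ?thesis .
  qed
  have D: "DERIV (MD_cgf \<nu> q m) \<theta> :>
      1 / \<mu> * max 0 (b * \<theta>) powr (1 / \<mu> - 1) * b + 1 / \<mu> * max 0 (- b * \<theta>) powr (1 / \<mu> - 1) * (- b)" for \<theta>
    unfolding cgf[abs_def] using \<mu>
    by (intro DERIV_add DERIV_chain2[OF DERIV_positive_part_powr] derivative_eq_intros) auto
  have I: "I_MD \<nu> q m x = ereal (u * y - u powr (1 / \<mu>))"
  proof -
    have "2 * x\<^sup>2 / q = y powr 2"
      using y b(1) q by (simp add: y_def power_divide b(2))
    hence "(2 * x\<^sup>2 / q) powr (1 / (2 - \<nu>)) = y powr (1 / (1 - \<mu>))"
      using \<nu> by (simp add: powr_powr \<mu>_def field_simps)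
    moreover have "\<mu> / (1 - \<mu>) = \<nu> / (2 - \<nu>)" "1 / (1 - \<mu>) = 2 / (2 - \<nu>)"
      using \<nu> by (auto simp: \<mu>_def field_simps)
    ultimately show ?thesis
      unfolding leg(2) using True by (simp add: I_MD_def \<mu>_def)
  qed
  define \<theta> where "\<theta> = (if 0 \<le> x then u / b else - u / b)"
  have b\<theta>: "b * \<theta> = (if 0 \<le> x then u else - u)" using b by (simp add: \<theta>_def)
  have "\<theta> * x = u * y" using b by (auto simp: \<theta>_def y_def)
  moreover have "MD_cgf \<nu> q m \<theta> = u powr (1 / \<mu>)"
    unfolding cgf using b\<theta> u by (auto simp: max_def)
  moreover have "DERIV (MD_cgf \<nu> q m) \<theta> :> x"
  proof -
    have "1 / \<mu> * max 0 (b * \<theta>) powr (1 / \<mu> - 1) * b + 1 / \<mu> * max 0 (- b * \<theta>) powr (1 / \<mu> - 1) * (- b)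
      = (if 0 \<le> x then b * y else - (b * y))"
      using b\<theta> u leg(1) by (auto simp: max_def)
    also have "\<dots> = x" using b by (simp add: y_def)
    finally show ?thesis using D[of \<theta>] by simp
  qed
  ultimately show ?thesis using I u y by (intro exI[of _ \<theta>]) auto
qed

text \<open>
  At a point of infinite rate \<open>x\<close> and \<open>m\<close> have opposite signs, so that for every slope \<open>\<theta>\<close> of the sign of \<open>x\<close> the limiting
  cumulant generating function vanishes and \<open>\<theta> x\<close> can be made arbitrarily large.
\<close>

lemma I_MD_dual:
  assumes \<nu>: "0 < \<nu>" "\<nu> < 1" and q: "m = 0 \<Longrightarrow> 0 < q" and K: "ereal K < I_MD \<nu> q m x"
  shows "\<exists>\<theta>. 0 \<le> \<theta> * x \<and> K < \<theta> * x - MD_cgf \<nu> q m \<theta>"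
proof (cases "I_MD \<nu> q m x = \<infinity>")
  case False
  thus ?thesis using I_MD_exposed[OF \<nu> q False] K by auto
next
  case True
  hence m: "m \<noteq> 0" "x / m < 0" by (auto simp: I_MD_def split: if_splits)
  define \<theta> where "\<theta> = (\<bar>K\<bar> + 1) / x"
  have "x \<noteq> 0" using m by auto
  hence "\<theta> * x = \<bar>K\<bar> + 1" by (simp add: \<theta>_def)
  moreover have "m * \<theta> \<le> 0"
    using m by (auto simp: \<theta>_def divide_less_0_iff mult_le_0_iff zero_le_divide_iff divide_le_0_iff)
  hence "MD_cgf \<nu> q m \<theta> = 0" using m by (simp add: MD_cgf_def)
  ultimately show ?thesis by (intro exI[of _ \<theta>]) auto
qed

lemma I_MD_constant_pos:
  fixes \<mu> :: real
  assumes "0 < \<mu>" "\<mu> < 1"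
  shows "0 < \<mu> powr (\<mu> / (1 - \<mu>)) - \<mu> powr (1 / (1 - \<mu>))"
proof -
  have "\<mu> / (1 - \<mu>) < 1 / (1 - \<mu>)" using assms by (simp add: divide_strict_right_mono)
  thus ?thesis using assms by (simp add: powr_less_mono')
qed

lemma compact_powr_sublevel:
  fixes f :: "real \<Rightarrow> real"
  assumes c: "0 < c" and p: "0 < p" and f: "continuous_on UNIV f" "\<And>x. 0 \<le> f x"
    and coercive: "\<And>r. bounded {x. f x \<le> r}"
  shows "compact {x. c * f x powr p \<le> b}"
proof -
  have "bounded {x. c * f x powr p \<le> b}"
  proof (rule bounded_subset[OF coercive[of "(b / c) powr (1 / p)"]])
    show "{x. c * f x powr p \<le> b} \<subseteq> {x. f x \<le> (b / c) powr (1 / p)}"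
    proof safe
      fix x assume "c * f x powr p \<le> b"
      hence "f x powr p \<le> b / c" using c by (simp add: field_simps)
      hence "(f x powr p) powr (1 / p) \<le> (b / c) powr (1 / p)"
        using p by (intro powr_mono2) auto
      thus "f x \<le> (b / c) powr (1 / p)" using p f(2) by (simp add: powr_powr)
    qed
  qed
  moreover have "closed {x. c * f x powr p \<le> b}"
    using p f by (intro closed_Collect_le continuous_intros continuous_on_powr') auto
  ultimately show ?thesis by (simp add: compact_eq_bounded_closed)
qed

text \<open>
  The sublevel sets at real levels are compact; closedness of all sublevel sets is lower semicontinuity. For
  \<open>m \<noteq> 0\<close> the sublevel set is cut out of one of the continuous function \<open>\<bar>x / m\<bar> powr (1 / (1 - \<nu>))\<close> by the closed
  half line \<open>x / m \<ge> 0\<close>.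
\<close>

lemma good_rate_function_I_MD:
  assumes \<nu>: "0 < \<nu>" "\<nu> < 1" and q: "m = 0 \<Longrightarrow> 0 < q"
  shows "good_rate_function (I_MD \<nu> q m)"
proof -
  let ?k = "\<lambda>\<mu>::real. \<mu> powr (\<mu> / (1 - \<mu>)) - \<mu> powr (1 / (1 - \<mu>))"
  have k0: "0 < (\<nu> / 2) powr (\<nu> / (2 - \<nu>)) - (\<nu> / 2) powr (2 / (2 - \<nu>))"
  proof -
    have "\<nu> / 2 / (1 - \<nu> / 2) = \<nu> / (2 - \<nu>)" "1 / (1 - \<nu> / 2) = 2 / (2 - \<nu>)"
      using \<nu> by (auto simp: field_simps)
    thus ?thesis using I_MD_constant_pos[of "\<nu> / 2"] \<nu> by simp
  qed
  note k1 = I_MD_constant_pos[OF \<nu>]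
  have nonneg: "0 \<le> I_MD \<nu> q m x" for x
    using k0 k1 by (auto simp: I_MD_def)
  have compact: "compact {x. I_MD \<nu> q m x \<le> ereal b}" for b
  proof (cases "m = 0")
    case True
    have q: "0 < q" using q True by simp
    have "bounded {x. 2 * x\<^sup>2 / q \<le> r}" for r
    proof (rule bounded_subset[OF bounded_cball[of 0 "sqrt (r * q / 2)"]])
      show "{x. 2 * x\<^sup>2 / q \<le> r} \<subseteq> cball 0 (sqrt (r * q / 2))"
        using q by (auto simp: field_simps intro!: real_le_rsqrt)
    qed
    hence "compact {x. ((\<nu> / 2) powr (\<nu> / (2 - \<nu>)) - (\<nu> / 2) powr (2 / (2 - \<nu>)))
        * (2 * x\<^sup>2 / q) powr (1 / (2 - \<nu>)) \<le> b}"
      using k0 \<nu> q by (intro compact_powr_sublevel continuous_intros) auto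
    thus ?thesis using True by (simp add: I_MD_def)
  next
    case False
    have "bounded {x. \<bar>x / m\<bar> \<le> r}" for r
      by (rule bounded_subset[OF bounded_cball[of 0 "r * \<bar>m\<bar>"]]) (use False in \<open>auto simp: field_simps\<close>)
    hence "compact {x. ?k \<nu> * \<bar>x / m\<bar> powr (1 / (1 - \<nu>)) \<le> b}"
      using k1 \<nu> False by (intro compact_powr_sublevel continuous_intros) auto
    moreover have "closed {x. 0 \<le> x / m}"
      using False by (intro closed_Collect_le continuous_intros) auto
    ultimately have "compact ({x. ?k \<nu> * \<bar>x / m\<bar> powr (1 / (1 - \<nu>)) \<le> b} \<inter> {x. 0 \<le> x / m})"
      by (rule compact_Int_closed)
    also have "{x. ?k \<nu> * \<bar>x / m\<bar> powr (1 / (1 - \<nu>)) \<le> b} \<inter> {x. 0 \<le> x / m} = {x. I_MD \<nu> q m x \<le> ereal b}"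
      using False by (auto simp: I_MD_def simp del: abs_divide)
    finally show ?thesis .
  qed
  have "I_MD \<nu> q m x \<le> Liminf (at x) (I_MD \<nu> q m)" for x
    unfolding le_Liminf_iff
  proof (intro allI impI)
    fix c assume c: "c < I_MD \<nu> q m x"
    have "closed {y. I_MD \<nu> q m y \<le> c}"
    proof (cases c)
      case (real r)
      thus ?thesis using compact_imp_closed[OF compact] by simp
    next
      case MInf
      hence "{y. I_MD \<nu> q m y \<le> c} = {}" using nonneg by (auto simp: not_le intro: less_le_trans[of _ 0])
      thus ?thesis by simp
    qed (use c in auto)
    hence "open (- {y. I_MD \<nu> q m y \<le> c})" by (rule open_Compl)
    hence "\<forall>\<^sub>F y in nhds x. y \<in> - {y. I_MD \<nu> q m y \<le> c}"
      using c by (intro eventually_nhds_in_open) auto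
    thus "\<forall>\<^sub>F y in at x. c < I_MD \<nu> q m y"
      by (auto simp: eventually_at_filter not_le elim: eventually_mono)
  qed
  with nonneg compact show ?thesis
    unfolding good_rate_function_def rate_function_def by blast
qed

section \<open>Moderate deviations\<close>

theorem proposition3p3:
  fixes M :: "'a measure"
    and S L :: "real \<Rightarrow> 'a \<Rightarrow> real"
    and a :: "real \<Rightarrow> real"
    and \<nu> m q :: real
  assumes "prob_space M"
    and "0 < \<nu>" and "\<nu> < 1"
    and "levy_process M S"
    and "cgf_finite_near_0 M (S 1)"
    and "inverse_stable_subordinator M \<nu> L"
    and "independent_processes M S L"
    and "m = deriv (cgf M (S 1)) 0"
    and "q = deriv (deriv (cgf M (S 1))) 0"
    and "m = 0 \<Longrightarrow> 0 < q"
    and "\<And>t. 0 < t \<Longrightarrow> 0 < a t"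
    and "(a \<longlongrightarrow> 0) at_top"
    and "filterlim (\<lambda>t. a t * t) at_top at_top"
  shows "LDP M (\<lambda>t \<omega>. (a t * t) powr MD_exponent \<nu> m * S (L t \<omega>) \<omega> / t)
           (\<lambda>t. 1 / a t) (I_MD \<nu> q m)
         \<and> good_rate_function (I_MD \<nu> q m)"
proof
  interpret prob_space M by fact
  note \<nu> = \<open>0 < \<nu>\<close> \<open>\<nu> < 1\<close> and S = \<open>levy_process M S\<close> and L = \<open>inverse_stable_subordinator M \<nu> L\<close>
    and q = \<open>m = 0 \<Longrightarrow> 0 < q\<close> and a_pos = \<open>\<And>t. 0 < t \<Longrightarrow> 0 < a t\<close>
  let ?\<kappa> = "cgf M (S 1)"
  have S1: "S 1 \<in> borel_measurable M" using S by (simp add: levy_process_def)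
  note \<kappa> = cgf_near_0[OF S1 \<open>cgf_finite_near_0 M (S 1)\<close>]
  have t_pos: "\<forall>\<^sub>F t in at_top. (0::real) < t" by (rule eventually_gt_at_top)
  have L_meas: "L t \<in> borel_measurable M" and L_nn: "\<And>\<omega>. \<omega> \<in> space M \<Longrightarrow> 0 \<le> L t \<omega>" if "0 < t" for t
    using L that by (auto simp: inverse_stable_subordinator_def)
  show good: "good_rate_function (I_MD \<nu> q m)"
    by (rule good_rate_function_I_MD[OF \<nu> q])
  define Z where "Z t \<omega> = (a t * t) powr MD_exponent \<nu> m * S (L t \<omega>) \<omega> / t" for t \<omega>
  \<comment> \<open>The process \<open>S\<close> enters only through its cumulant generating function at \<open>s \<theta> t\<close>, which tends to \<open>0\<close>.\<close>
  define s where "s \<theta> t = \<theta> * (a t * t) powr (MD_exponent \<nu> m - 1)" for \<theta> t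
  have scaled: "\<theta> / a t * Z t \<omega> = s \<theta> t * S (L t \<omega>) \<omega>" if "0 < t" for \<theta> t \<omega>
    using a_pos[OF that] that by (simp add: Z_def s_def powr_diff field_simps)
  have exponent: "MD_exponent \<nu> m - 1 < 0" using \<nu> by (auto simp: MD_exponent_def)
  have s_lim: "(s \<theta> \<longlongrightarrow> 0) at_top" for \<theta>
  proof -
    have "((\<lambda>t. (a t * t) powr (MD_exponent \<nu> m - 1)) \<longlongrightarrow> 0) at_top"
      using exponent \<open>filterlim (\<lambda>t. a t * t) at_top at_top\<close> by (intro tendsto_neg_powr)
    thus ?thesis unfolding s_def[abs_def] using tendsto_mult_right_zero by blast
  qed
  have exp_int: "\<forall>\<^sub>F t in at_top. integrable M (\<lambda>\<omega>. exp (s \<theta> t * S 1 \<omega>))" for \<theta>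
    using \<open>cgf_finite_near_0 M (S 1)\<close> s_lim[of \<theta>]
    unfolding cgf_finite_near_0_def by (rule eventually_compose_filterlim)
  have mgf: "\<forall>\<^sub>F t in at_top. integrable M (\<lambda>\<omega>. exp (\<theta> / a t * Z t \<omega>)) \<and>
      expectation (\<lambda>\<omega>. exp (\<theta> / a t * Z t \<omega>)) = expectation (\<lambda>\<omega>. exp (?\<kappa> (s \<theta> t) * L t \<omega>))" for \<theta>
    using exp_int[of \<theta>] exp_int[of "2 * \<theta>"] t_pos
  proof eventually_elim
    case (elim t)
    have int: "integrable M (\<lambda>\<omega>. exp (r * S 1 \<omega>))" if "r \<in> {s \<theta> t, 2 * s \<theta> t}" for r
      using elim that by (auto simp: s_def mult.assoc)
    have t: "0 < t" by fact
    show ?case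
      unfolding scaled[OF t]
      using levy_mgf_at_independent_time[OF S int L_meas[OF t] L_nn[OF t]
          inverse_subordinator_mgf_integrable[OF \<nu>(1) L less_imp_le[OF t]]
          independent_processes_indep_var[OF \<open>independent_processes M S L\<close> _ less_imp_le[OF t]]]
      by blast
  qed
  have \<kappa>_lim: "((\<lambda>t. ?\<kappa> (s \<theta> t) * (a t * t) powr \<nu>)
      \<longlongrightarrow> (if m = 0 then q * \<theta>\<^sup>2 / 2 else m * \<theta>)) at_top" for \<theta>
  proof (cases "\<theta> = 0")
    case True
    thus ?thesis by (simp add: s_def cgf_def prob_space)
  next
    case False
    have s_nz: "\<forall>\<^sub>F t in at_top. s \<theta> t \<noteq> 0"
      using t_pos by eventually_elim (use False a_pos in \<open>force simp: s_def\<close>)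
    hence s_at: "filterlim (s \<theta>) (at 0) at_top"
      using s_lim by (simp add: filterlim_at)
    show ?thesis
    proof (cases "m = 0")
      case True
      have "((\<lambda>t. ?\<kappa> (s \<theta> t) / (s \<theta> t)\<^sup>2 * \<theta>\<^sup>2) \<longlongrightarrow> q / 2 * \<theta>\<^sup>2) at_top"
        using filterlim_compose[OF \<kappa>(2) s_at] True assms(8,9) by (intro tendsto_mult tendsto_const) simp
      moreover have "\<forall>\<^sub>F t in at_top. ?\<kappa> (s \<theta> t) / (s \<theta> t)\<^sup>2 * \<theta>\<^sup>2 = ?\<kappa> (s \<theta> t) * (a t * t) powr \<nu>"
        using t_pos
      proof eventually_elim
        case (elim t)
        have "((a t * t) powr (- \<nu> / 2))\<^sup>2 = (a t * t) powr (- \<nu>)"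
          by (simp add: power2_eq_square flip: powr_add)
        hence "(s \<theta> t)\<^sup>2 = \<theta>\<^sup>2 / (a t * t) powr \<nu>"
          using True by (simp add: s_def MD_exponent_def power_mult_distrib power_divide powr_minus_divide)
        thus ?case using False by simp
      qed
      ultimately show ?thesis using True by (auto intro: Lim_transform_eventually)
    next
      case m: False
      have "((\<lambda>t. ?\<kappa> (s \<theta> t) / s \<theta> t * \<theta>) \<longlongrightarrow> m * \<theta>) at_top"
        using filterlim_compose[OF \<kappa>(1) s_at] assms(8) by (intro tendsto_mult tendsto_const) simp
      moreover have "\<forall>\<^sub>F t in at_top. ?\<kappa> (s \<theta> t) / s \<theta> t * \<theta> = ?\<kappa> (s \<theta> t) * (a t * t) powr \<nu>"
        using t_pos
      proof eventually_elim
        case (elim t)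
        have "s \<theta> t = \<theta> / (a t * t) powr \<nu>"
          using m by (simp add: s_def MD_exponent_def powr_minus_divide)
        thus ?case using False by simp
      qed
      ultimately show ?thesis using m by (auto intro: Lim_transform_eventually)
    qed
  qed
  have "LDP M Z (\<lambda>t. 1 / a t) (I_MD \<nu> q m)"
  proof (rule Gartner_Ellis_real[where \<Lambda> = "MD_cgf \<nu> q m"])
    show "Z t \<in> borel_measurable M" if "0 < t" for t
      unfolding Z_def using levy_at_random_time_measurable[OF S L_meas[OF that] L_nn[OF that]] by simp
    show "\<forall>\<^sub>F t in at_top. integrable M (\<lambda>\<omega>. exp (\<theta> / a t * Z t \<omega>))" for \<theta>
      using mgf[of \<theta>] by eventually_elim simp
    show "((\<lambda>t. a t * ln (expectation (\<lambda>\<omega>. exp (\<theta> / a t * Z t \<omega>)))) \<longlongrightarrow> MD_cgf \<nu> q m \<theta>) at_top" for \<theta>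
    proof (rule Lim_transform_eventually)
      show "((\<lambda>t. a t * ln (expectation (\<lambda>\<omega>. exp (?\<kappa> (s \<theta> t) * L t \<omega>)))) \<longlongrightarrow> MD_cgf \<nu> q m \<theta>) at_top"
        unfolding MD_cgf_def
        by (rule inverse_subordinator_log_mgf_limit[OF \<nu> L a_pos \<open>(a \<longlongrightarrow> 0) at_top\<close> \<kappa>_lim])
      show "\<forall>\<^sub>F t in at_top. a t * ln (expectation (\<lambda>\<omega>. exp (?\<kappa> (s \<theta> t) * L t \<omega>)))
        = a t * ln (expectation (\<lambda>\<omega>. exp (\<theta> / a t * Z t \<omega>)))"
        using mgf[of \<theta>] by eventually_elim simp
    qed
    show "rate_function (I_MD \<nu> q m)" using good by (simp add: good_rate_function_def)
    show "I_MD \<nu> q m 0 = 0" by (simp add: I_MD_def)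
    show "\<exists>\<theta>. 0 \<le> \<theta> * x \<and> K < \<theta> * x - MD_cgf \<nu> q m \<theta>" if "ereal K < I_MD \<nu> q m x" for x K
      by (rule I_MD_dual[OF \<nu> q that])
    show "\<exists>\<theta>. DERIV (MD_cgf \<nu> q m) \<theta> :> x \<and> ereal (\<theta> * x - MD_cgf \<nu> q m \<theta>) \<le> I_MD \<nu> q m x"
      if "I_MD \<nu> q m x \<noteq> \<infinity>" for x
      using I_MD_exposed[OF \<nu> q that] by auto
  qed (use a_pos \<open>(a \<longlongrightarrow> 0) at_top\<close> in auto)
  thus "LDP M (\<lambda>t \<omega>. (a t * t) powr MD_exponent \<nu> m * S (L t \<omega>) \<omega> / t) (\<lambda>t. 1 / a t) (I_MD \<nu> q m)"
    by (simp only: Z_def[abs_def])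
qed

end
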